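(* Let $0<p\le q$ and $n=p+q$. The rational loop group $\mathcal{L}^-\mathrm{U}_{p,q}$ is generated (as a group) by the following two families of loops: (1) $p_{\alpha,L}(\lambda)=\left(\frac{\lambda-\alpha}{\lambda-\bar\alpha}\right)\pi_L+\pi_{L^\perp}$, where $\alpha\in\mathbb{C}$ and $L\subset\mathbb{C}^n$ is a non-isotropic complex line (so $\mathbb{C}^n=L\oplus L^\perp$, and $\pi_L,\pi_{L^\perp}$ are the projections of this decomposition); (2) $g_{\alpha,\beta,L,K,W}(\lambda)=\left(\frac{\lambda-\alpha}{\lambda-\beta}\right)\pi_L+\left(\frac{\lambda-\bar\beta}{\lambda-\bar\alpha}\right)\pi_K+\pi_W$, where $\alpha,\beta\in\mathbb{C}$, $L,K\subset\mathbb{C}^n$ are isotropic complex lines with $\langle L,K\rangle\neq 0$, $W:=L^\perp\cap K^\perp$, and $\pi_L,\pi_K,\pi_W$ are the projections of the decomposition $\mathbb{C}^n=L\oplus K\oplus W$ onto each summand along the sum of the other two.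
   Context: On $\mathbb{C}^n$, $n=p+q$, let $\langle v,w\rangle=-\sum_{i=1}^p\overline{v_i}w_i+\sum_{i=p+1}^{p+q}\overline{v_i}w_i$. The symbol $\perp$ refers to orthogonality with respect to $\langle\cdot,\cdot\rangle$; a subspace is isotropic if $\langle\cdot,\cdot\rangle$ vanishes identically on it. For lines $L,K$, $\langle L,K\rangle\ne0$ means $\langle v,w\rangle\neq0$ for nonzero $v\in L,w\in K$. Put $s=\mathrm{diag}(-\mathrm{I}_p,\mathrm{I}_q)$; $A^*=s\bar A^t s$ is the adjoint with respect to $\langle\cdot,\cdot\rangle$. $\mathcal{L}^-\mathrm{GL}_n\mathbb{C}$ is the group of all non-degenerate (determinant not identically zero) $n\times n$ matrices $g(\lambda)$ of complex rational functions with $g(\infty)=\mathrm{I}$, and $\mathcal{L}^-\mathrm{U}_{p,q}$ is its subgroup of loops satisfying the $\mathrm{U}_{p,q}$-reality condition $(g(\bar\lambda)^* )^{-1}=g(\lambda)$. *)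

theory Defs
  imports
    "HOL-Analysis.Analysis"
    "HOL-Computational_Algebra.Computational_Algebra"
    "HOL-Algebra.Generated_Groups"
begin

section \<open>Complex rational functions\<close>

type_synonym ratfun = "complex poly fract"

text \<open>The value at infinity is a limit. It does not depend on the representation as a quotient,
  as two representations agree off a finite set.\<close>

definition has_value_at_infinity :: "ratfun \<Rightarrow> complex \<Rightarrow> bool" where
  "has_value_at_infinity r c \<longleftrightarrow>
     (\<exists>a b. b \<noteq> 0 \<and> r = Fract a b \<and> ((\<lambda>z. poly a z / poly b z) \<longlongrightarrow> c) at_infinity)"

lemma map_poly_cnj_mult: "map_poly cnj (a * b) = map_poly cnj a * map_poly cnj b"
  by (rule poly_eqI) (simp add: coeff_map_poly coeff_mult)

lemma map_poly_cnj_eq_0_iff: "map_poly cnj a = 0 \<longleftrightarrow> a = 0"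
  by (simp add: poly_eq_iff coeff_map_poly)

text \<open>The rational function whose value at \<open>\<lambda>\<close> is the conjugate of the value of \<open>r\<close> at the
  conjugate of \<open>\<lambda>\<close>; on polynomials this conjugates the coefficients
  (\<open>poly_map_poly_cnj\<close> in the library).\<close>

definition cnj_ratfun :: "ratfun \<Rightarrow> ratfun" where
  "cnj_ratfun r =
     (THE s. \<exists>a b. b \<noteq> 0 \<and> r = Fract a b \<and> s = Fract (map_poly cnj a) (map_poly cnj b))"

lemma cnj_ratfun_Fract:
  assumes "b \<noteq> 0"
  shows "cnj_ratfun (Fract a b) = Fract (map_poly cnj a) (map_poly cnj b)"
  unfolding cnj_ratfun_def
proof (rule the_equality)
  fix s
  assume "\<exists>c d. d \<noteq> 0 \<and> Fract a b = Fract c d \<and> s = Fract (map_poly cnj c) (map_poly cnj d)"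
  then obtain c d where "d \<noteq> 0" and "Fract a b = Fract c d"
    and s: "s = Fract (map_poly cnj c) (map_poly cnj d)" by blast
  then have "a * d = c * b"
    using assms by (simp add: eq_fract)
  then have "map_poly cnj a * map_poly cnj d = map_poly cnj c * map_poly cnj b"
    by (metis map_poly_cnj_mult)
  with assms \<open>d \<noteq> 0\<close> show "s = Fract (map_poly cnj a) (map_poly cnj b)"
    by (simp add: s eq_fract map_poly_cnj_eq_0_iff)
qed (rule exI[of _ a], rule exI[of _ b], simp add: assms)

section \<open>The Hermitian form of signature \<open>(p, q)\<close>\<close>

text \<open>Coordinates of \<open>\<complex>\<^sup>n\<close>, \<open>n = p + q\<close>, are indexed by a sum type \<open>'p + 'q\<close> of two finite types
  with \<open>p\<close> and \<open>q\<close> elements: the \<open>Inl\<close>-coordinates are the first \<open>p\<close> (negative) ones.\<close>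

definition herm :: "complex^('p::finite + 'q::finite) \<Rightarrow> complex^('p + 'q) \<Rightarrow> complex" where
  "herm v w = - (\<Sum>i\<in>UNIV. cnj (v $ Inl i) * w $ Inl i) + (\<Sum>i\<in>UNIV. cnj (v $ Inr i) * w $ Inr i)"

definition complex_line :: "(complex^'n) set \<Rightarrow> bool" where
  "complex_line L \<longleftrightarrow> vec.subspace L \<and> vec.dim L = 1"

definition isotropic :: "(complex^('p::finite + 'q::finite)) set \<Rightarrow> bool" where
  "isotropic S \<longleftrightarrow> (\<forall>v\<in>S. \<forall>w\<in>S. herm v w = 0)"

definition perp :: "(complex^('p::finite + 'q::finite)) set \<Rightarrow> (complex^('p + 'q)) set" where
  "perp S = {w. \<forall>v\<in>S. herm v w = 0}"

definition lines_nonorthogonal ::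
    "(complex^('p::finite + 'q::finite)) set \<Rightarrow> (complex^('p + 'q)) set \<Rightarrow> bool" where
  "lines_nonorthogonal L K \<longleftrightarrow> (\<forall>v\<in>L - {0}. \<forall>w\<in>K - {0}. herm v w \<noteq> 0)"

definition sum_space :: "(complex^'n) set \<Rightarrow> (complex^'n) set \<Rightarrow> (complex^'n) set" where
  "sum_space A B = {a + b | a b. a \<in> A \<and> b \<in> B}"

text \<open>The matrix of the projection onto \<open>A\<close> along \<open>B\<close>. Only meaningful if \<open>\<complex>\<^sup>n\<close> is the direct sum
  of the subspaces \<open>A\<close> and \<open>B\<close>.\<close>

definition proj :: "(complex^'n) set \<Rightarrow> (complex^'n) set \<Rightarrow> complex^'n^'n" where
  "proj A B = matrix (\<lambda>v. THE a. a \<in> A \<and> v - a \<in> B)"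

section \<open>Rational loop groups\<close>

text \<open>The group \<open>\<L>\<^sup>- GL\<^sub>n \<complex>\<close>.\<close>

definition LGL :: "(ratfun^'n^'n) monoid" where
  "LGL = \<lparr>carrier = {g. det g \<noteq> 0 \<and>
                         (\<forall>i j. has_value_at_infinity (g $ i $ j) (mat 1 $ i $ j))},
          mult = (**), one = mat 1\<rparr>"

definition sgn_matrix :: "ratfun^('p::finite + 'q::finite)^('p + 'q)" where
  "sgn_matrix = (\<chi> i j. if i = j then (case i of Inl _ \<Rightarrow> - 1 | Inr _ \<Rightarrow> 1) else 0)"

text \<open>The loop \<open>\<lambda> \<mapsto> g(cnj \<lambda>)\<^sup>*\<close>, where \<open>A\<^sup>*\<close> is the adjoint of \<open>A\<close> with respect to \<^const>\<open>herm\<close>.\<close>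

definition loop_star ::
    "ratfun^('p::finite + 'q::finite)^('p + 'q) \<Rightarrow> ratfun^('p + 'q)^('p + 'q)" where
  "loop_star g = sgn_matrix ** transpose (\<chi> i j. cnj_ratfun (g $ i $ j)) ** sgn_matrix"

text \<open>The underlying set of \<open>\<L>\<^sup>- U\<^sub>p\<^sub>,\<^sub>q\<close>.\<close>

definition LU :: "(ratfun^('p::finite + 'q::finite)^('p + 'q)) set" where
  "LU = {g \<in> carrier LGL. matrix_inv (loop_star g) = g}"

section \<open>The simple elements\<close>

text \<open>The linear fractional function \<open>(\<lambda> - a) / (\<lambda> - b)\<close>.\<close>

definition lin_frac :: "complex \<Rightarrow> complex \<Rightarrow> ratfun" where
  "lin_frac a b = Fract [:- a, 1:] [:- b, 1:]"

definition scale_loop :: "ratfun \<Rightarrow> complex^'n^'n \<Rightarrow> ratfun^'n^'n" where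
  "scale_loop r A = (\<chi> i j. r * to_fract [:A $ i $ j:])"

definition p_loop ::
    "complex \<Rightarrow> (complex^('p::finite + 'q::finite)) set \<Rightarrow> ratfun^('p + 'q)^('p + 'q)" where
  "p_loop \<alpha> L =
     scale_loop (lin_frac \<alpha> (cnj \<alpha>)) (proj L (perp L)) + scale_loop 1 (proj (perp L) L)"

definition g_loop ::
    "complex \<Rightarrow> complex \<Rightarrow> (complex^('p::finite + 'q::finite)) set \<Rightarrow> (complex^('p + 'q)) set
      \<Rightarrow> ratfun^('p + 'q)^('p + 'q)" where
  "g_loop \<alpha> \<beta> L K =
     (let W = perp L \<inter> perp K in
        scale_loop (lin_frac \<alpha> \<beta>) (proj L (sum_space K W)) +
        scale_loop (lin_frac (cnj \<beta>) (cnj \<alpha>)) (proj K (sum_space L W)) +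
        scale_loop 1 (proj W (sum_space L K)))"

definition p_family :: "(ratfun^('p::finite + 'q::finite)^('p + 'q)) set" where
  "p_family = {p_loop \<alpha> L | \<alpha> L. complex_line L \<and> \<not> isotropic L}"

definition g_family :: "(ratfun^('p::finite + 'q::finite)^('p + 'q)) set" where
  "g_family = {g_loop \<alpha> \<beta> L K | \<alpha> \<beta> L K.
     complex_line L \<and> complex_line K \<and> isotropic L \<and> isotropic K \<and> lines_nonorthogonal L K}"

end

theory Submission
  imports Defs
begin

text \<open>Rational functions that are finite at infinity form a local ring \<open>O\<close> with involution and
  maximal ideal \<open>m\<close>, the functions vanishing at infinity. The loop group is the congruence
  subgroup of the unitary group over \<open>O\<close> modulo \<open>m\<close>, so Gaussian elimination applies: every pivot
  is congruent to a nonzero constant and hence a unit.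

  Let \<open>\<langle>u, w\<rangle> = 1\<close> with \<open>u\<close>, \<open>w\<close> constant and isotropic. The products of the loops (2) along the
  lines of \<open>u\<close> and \<open>w\<close> are the maps \<open>u \<mapsto> r u\<close>, \<open>w \<mapsto> w / bar r\<close> with arbitrary \<open>r \<in> 1 + m\<close>. Replacing
  \<open>w\<close> by another constant vector \<open>w'\<close> and dividing the two maps yields Siegel transformations, with
  parameters in \<open>m\<close>. These suffice to move any unit vector congruent to a basis vector \<open>e\<close> to \<open>e\<close>,
  as long as the form is indefinite. Splitting off basis vectors one after the other, in such an
  order that the form remains indefinite until one dimension is left, reduces the theorem to scalars
  \<open>r \<in> 1 + m\<close> with \<open>r bar r = 1\<close>, which are products of the loops (1) by Hilbert 90.\<close>

no_notation fps_nth (infixl \<open>$\<close> 75)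

section \<open>Rational functions and their values at infinity\<close>

abbreviation bar :: "ratfun \<Rightarrow> ratfun" where "bar \<equiv> cnj_ratfun"

abbreviation val_inf :: "ratfun \<Rightarrow> complex \<Rightarrow> bool" where "val_inf \<equiv> has_value_at_infinity"

section \<open>Constant functions and conjugation on the field of rational functions\<close>

definition cst :: "complex \<Rightarrow> ratfun" where "cst c = to_fract [:c:]"

lemma cst_simps [simp]:
  "cst 0 = 0" "cst 1 = 1" "cst (a + b) = cst a + cst b" "cst (a - b) = cst a - cst b"
  "cst (- a) = - cst a" "cst (a * b) = cst a * cst b" "cst a = cst b \<longleftrightarrow> a = b"
  "cst a = 0 \<longleftrightarrow> a = 0"
  by (simp_all add: cst_def flip: to_fract_add to_fract_diff to_fract_uminus to_fract_mult
      one_pCons to_fract_1)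

lemma cst_sum: "cst (sum f A) = (\<Sum>i\<in>A. cst (f i))"
  by (induction A rule: infinite_finite_induct) simp_all

lemma cst_divide [simp]: "cst (a / b) = cst a / cst b"
proof (cases "b = 0")
  case False
  then have "cst (a / b) * cst b = cst a"
    by (simp flip: cst_simps(6))
  with False show ?thesis by (simp add: field_simps)
qed simp

lemma cst_numeral [simp]: "cst (numeral n) = numeral n"
proof -
  have "cst (of_nat k) = of_nat k" for k by (induction k) simp_all
  from this[of "numeral n"] show ?thesis by simp
qed

lemma map_poly_cnj_add: "map_poly cnj (a + b) = map_poly cnj a + map_poly cnj b"
  by (rule poly_eqI) (simp add: coeff_map_poly)

lemma bar_add [simp]: "bar (x + y) = bar x + bar y"
  by (cases x; cases y) (simp add: cnj_ratfun_Fract map_poly_cnj_eq_0_iff map_poly_cnj_mult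
      map_poly_cnj_add)

lemma bar_mult [simp]: "bar (x * y) = bar x * bar y"
  by (cases x; cases y) (simp add: cnj_ratfun_Fract map_poly_cnj_eq_0_iff map_poly_cnj_mult)

lemma bar_cst [simp]: "bar (cst c) = cst (cnj c)"
  by (simp add: cst_def to_fract_def cnj_ratfun_Fract map_poly_pCons)

lemma bar_bar [simp]: "bar (bar x) = x"
  by (cases x) (simp add: cnj_ratfun_Fract map_poly_cnj_eq_0_iff map_poly_map_poly o_def)

lemma bar_0 [simp]: "bar 0 = 0" and bar_1 [simp]: "bar 1 = 1"
  using bar_cst[of 0] bar_cst[of 1] by simp_all

lemma bar_minus [simp]: "bar (- x) = - bar x"
  using bar_add[of x "- x"] by (simp add: eq_neg_iff_add_eq_0 add.commute del: bar_add)

lemma bar_diff [simp]: "bar (x - y) = bar x - bar y"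
  using bar_add[of x "- y"] by simp

lemma bar_eq_0_iff [simp]: "bar x = 0 \<longleftrightarrow> x = 0"
  by (metis bar_0 bar_bar)

lemma bar_divide [simp]: "bar (x / y) = bar x / bar y"
proof (cases "y = 0")
  case False
  then have "bar (x / y) * bar y = bar x" by (simp flip: bar_mult)
  with False show ?thesis by (simp add: field_simps)
qed simp

lemma bar_numeral [simp]: "bar (numeral n) = numeral n"
  using bar_cst[of "numeral n"] by simp

lemma bar_sum: "bar (sum f A) = (\<Sum>i\<in>A. bar (f i))"
  by (induction A rule: infinite_finite_induct) simp_all

section \<open>The local ring of functions finite at infinity\<close>

lemma eventually_poly_neq_0:
  fixes p :: "complex poly"
  assumes "p \<noteq> 0"
  shows "eventually (\<lambda>z. poly p z \<noteq> 0) at_infinity"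
  using tendsto_imp_eventually_ne[OF poly_divide_tendsto_aux[of p], of 0] assms
  by (auto elim: eventually_mono)

lemma val_infI:
  assumes "b \<noteq> 0" and "eventually (\<lambda>z. poly a z / poly b z = f z) at_infinity"
    and "(f \<longlongrightarrow> c) at_infinity"
  shows "val_inf (Fract a b) c"
  using assms tendsto_cong[of "\<lambda>z. poly a z / poly b z" f] unfolding has_value_at_infinity_def
  by blast

lemma val_infE:
  assumes "val_inf r c"
  obtains a b where "b \<noteq> 0" "r = Fract a b" "((\<lambda>z. poly a z / poly b z) \<longlongrightarrow> c) at_infinity"
  using assms unfolding has_value_at_infinity_def by blast

lemma val_inf_cst [simp]: "val_inf (cst c) c"
  unfolding cst_def to_fract_def by (rule val_infI[where f = "\<lambda>_. c"]) auto

lemma val_inf_0 [simp]: "val_inf 0 0" and val_inf_1 [simp]: "val_inf 1 1"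
  using val_inf_cst[of 0] val_inf_cst[of 1] by simp_all

lemma val_inf_add:
  assumes "val_inf r c" and "val_inf s d"
  shows "val_inf (r + s) (c + d)"
proof -
  obtain a b where 1: "b \<noteq> 0" "r = Fract a b" "((\<lambda>z. poly a z / poly b z) \<longlongrightarrow> c) at_infinity"
    using assms(1) by (rule val_infE)
  obtain a' b' where 2: "b' \<noteq> 0" "s = Fract a' b'"
    "((\<lambda>z. poly a' z / poly b' z) \<longlongrightarrow> d) at_infinity"
    using assms(2) by (rule val_infE)
  have "eventually (\<lambda>z. poly (a * b' + a' * b) z / poly (b * b') z
      = poly a z / poly b z + poly a' z / poly b' z) at_infinity"
    using eventually_poly_neq_0[OF 1(1)] eventually_poly_neq_0[OF 2(1)]
    by eventually_elim (simp add: field_simps)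
  then show ?thesis
    unfolding 1(2) 2(2) add_fract[OF 1(1) 2(1)]
    using 1 2 by (intro val_infI[OF _ _ tendsto_add[OF 1(3) 2(3)]]) auto
qed

lemma val_inf_mult:
  assumes "val_inf r c" and "val_inf s d"
  shows "val_inf (r * s) (c * d)"
proof -
  obtain a b where 1: "b \<noteq> 0" "r = Fract a b" "((\<lambda>z. poly a z / poly b z) \<longlongrightarrow> c) at_infinity"
    using assms(1) by (rule val_infE)
  obtain a' b' where 2: "b' \<noteq> 0" "s = Fract a' b'"
    "((\<lambda>z. poly a' z / poly b' z) \<longlongrightarrow> d) at_infinity"
    using assms(2) by (rule val_infE)
  show ?thesis
    unfolding 1(2) 2(2) mult_fract
    using 1 2 by (intro val_infI[OF _ _ tendsto_mult[OF 1(3) 2(3)]]) auto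
qed

lemma val_inf_minus: "val_inf r c \<Longrightarrow> val_inf (- r) (- c)"
  using val_inf_mult[OF val_inf_cst[of "-1"], of r c] by simp

lemma val_inf_diff: "val_inf r c \<Longrightarrow> val_inf s d \<Longrightarrow> val_inf (r - s) (c - d)"
  using val_inf_add[OF _ val_inf_minus, of r c s d] by simp

lemma val_inf_sum:
  "(\<And>i. i \<in> A \<Longrightarrow> val_inf (f i) (c i)) \<Longrightarrow> val_inf (sum f A) (sum c A)"
  by (induction A rule: infinite_finite_induct) (simp_all add: val_inf_add)

text \<open>Every numerator representing \<open>0\<close> is itself \<open>0\<close>, so the limit
  is that of a constant. Uniqueness for all functions then follows by taking differences.\<close>

lemma val_inf_0_unique:
  assumes "val_inf 0 c" shows "c = 0"
proof -
  obtain a b where 1: "b \<noteq> 0" "0 = Fract a b" "((\<lambda>z. poly a z / poly b z) \<longlongrightarrow> c) at_infinity"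
    using assms by (rule val_infE)
  then have "a = 0" by (simp add: Zero_fract_def eq_fract)
  with 1(3) show ?thesis
    by (simp add: tendsto_const_iff trivial_limit_at_infinity)
qed

lemma val_inf_unique: "val_inf r c \<Longrightarrow> val_inf r d \<Longrightarrow> c = d"
  using val_inf_0_unique[of "c - d"] val_inf_diff[of r c r d] by simp

lemma val_inf_neq_0: "val_inf r c \<Longrightarrow> c \<noteq> 0 \<Longrightarrow> r \<noteq> 0"
  using val_inf_0_unique by blast

text \<open>A nonzero limit may be inverted. These functions are the units of the local ring, which
  makes the pivots of the elimination invertible.\<close>

lemma val_inf_inverse:
  assumes "val_inf r c" "c \<noteq> 0" shows "val_inf (inverse r) (inverse c)"
proof -
  obtain a b where 1: "b \<noteq> 0" "r = Fract a b" "((\<lambda>z. poly a z / poly b z) \<longlongrightarrow> c) at_infinity"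
    using assms(1) by (rule val_infE)
  have "a \<noteq> 0" using val_inf_neq_0[OF assms] 1(2) by (auto simp: fract_collapse)
  then show ?thesis
    unfolding 1(2) inverse_fract
    by (intro val_infI[OF _ _ tendsto_inverse[OF 1(3) assms(2)]]) auto
qed

lemma val_inf_divide: "val_inf r c \<Longrightarrow> val_inf s d \<Longrightarrow> d \<noteq> 0 \<Longrightarrow> val_inf (r / s) (c / d)"
  using val_inf_mult[OF _ val_inf_inverse, of r c s d] by (simp add: field_simps)

lemma val_inf_bar:
  assumes "val_inf r c" shows "val_inf (bar r) (cnj c)"
proof -
  obtain a b where 1: "b \<noteq> 0" "r = Fract a b" "((\<lambda>z. poly a z / poly b z) \<longlongrightarrow> c) at_infinity"
    using assms(1) by (rule val_infE)
  have "filterlim cnj at_infinity (at_infinity :: complex filter)"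
    by (auto simp: filterlim_at_infinity[of 0] eventually_at_infinity)
  from filterlim_compose[OF tendsto_cnj[OF 1(3)] this] show ?thesis
    unfolding 1(2) cnj_ratfun_Fract[OF 1(1)]
    by (intro val_infI) (use 1 in \<open>auto simp: map_poly_cnj_eq_0_iff filterlim_def filtermap_filtermap\<close>)
qed

section \<open>Linear fractional factors\<close>

lemma lin_frac_neq_0 [simp]: "lin_frac \<alpha> \<beta> \<noteq> 0"
  by (simp add: lin_frac_def Fract_conv_to_fract)

lemma bar_lin_frac [simp]: "bar (lin_frac \<alpha> \<beta>) = lin_frac (cnj \<alpha>) (cnj \<beta>)"
  by (simp add: lin_frac_def cnj_ratfun_Fract map_poly_pCons)

lemma inverse_lin_frac [simp]: "inverse (lin_frac \<alpha> \<beta>) = lin_frac \<beta> \<alpha>"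
  by (simp add: lin_frac_def)

text \<open>Equal degrees give the quotient of the leading coefficients, a smaller numerator gives
  \<open>0\<close>, and a larger one makes the inverse tend to \<open>0\<close>. As
  \<open>c \<noteq> 0\<close>, uniqueness leaves only the first case.\<close>

lemma val_inf_Fract_iff:
  assumes "a \<noteq> 0" "b \<noteq> 0" "c \<noteq> 0"
  shows "val_inf (Fract a b) c \<longleftrightarrow> degree a = degree b \<and> lead_coeff a = c * lead_coeff b"
proof
  have eq: "val_inf (Fract a b) (lead_coeff a / lead_coeff b)"
    if "degree a = degree b" "a \<noteq> 0" "b \<noteq> 0" for a b
  proof (rule val_infI[OF \<open>b \<noteq> 0\<close> _ tendsto_divide[OF poly_divide_tendsto_aux poly_divide_tendsto_aux]])
    show "\<forall>\<^sub>F z in at_infinity. poly a z / poly b z = poly a z / z ^ degree a / (poly b z / z ^ degree b)"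
      by (rule eventually_at_infinityI[of 1]) (use that in auto)
  qed (use that in simp)
  show "val_inf (Fract a b) c" if "degree a = degree b \<and> lead_coeff a = c * lead_coeff b"
  proof -
    from that have l: "lead_coeff a = c * lead_coeff b" by blast
    have "lead_coeff a / lead_coeff b = c" unfolding l using assms(2) by simp
    with eq[of a b] that assms show ?thesis by metis
  qed
  assume v: "val_inf (Fract a b) c"
  have lt: "val_inf (Fract a b) 0" if "degree a < degree b" for a b
    using that by (intro val_infI[OF _ _ poly_divide_tendsto_0_at_infinity[OF that]]) auto
  have "\<not> degree a < degree b"
    using lt[of a b] val_inf_unique[OF v, of 0] assms(3) by auto
  moreover have "\<not> degree b < degree a"
    using lt[of b a] val_inf_unique[OF val_inf_inverse[OF v assms(3)], of 0] assms(3) by auto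
  ultimately have "degree a = degree b" by simp
  with eq[of a b] val_inf_unique[OF v] assms
  show "degree a = degree b \<and> lead_coeff a = c * lead_coeff b" by force
qed

lemma val_inf_lin_frac [simp]: "val_inf (lin_frac \<alpha> \<beta>) 1"
  by (simp add: lin_frac_def val_inf_Fract_iff)

lemma monic_linear_factor:
  fixes a :: "complex poly"
  assumes "lead_coeff a = 1" "degree a = Suc n"
  obtains z a' where "a = [:- z, 1:] * a'" "lead_coeff a' = 1" "degree a' = n"
proof -
  obtain z where "poly a z = 0"
    using alg_closed_imp_poly_has_root[of a] assms by auto
  then obtain a' where a': "a = [:- z, 1:] * a'"
    by (metis dvdE poly_eq_0_iff_dvd)
  have "a' \<noteq> 0" using assms a' by auto
  then have "degree a = degree [:- z, 1:] + degree a'"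
    unfolding a' by (intro degree_mult_eq) auto
  with assms have "degree a' = n" by simp
  moreover have "lead_coeff a' = 1"
    using assms(1) unfolding a' lead_coeff_mult by simp
  ultimately show thesis using that a' by blast
qed

text \<open>A function with value \<open>1\<close> is a quotient of monic polynomials of equal
  degree. Their roots can be paired in any order, each pair contributing one factor
  \<open>lin_frac\<close>.\<close>

lemma val_inf_1_induct [consumes 1, case_names one mult]:
  assumes "val_inf r 1"
    and "P 1" and lin: "\<And>\<alpha> \<beta> r. P r \<Longrightarrow> P (lin_frac \<alpha> \<beta> * r)"
  shows "P r"
proof -
  have monic: "P (Fract a b)"
    if "lead_coeff a = 1" "lead_coeff b = 1" "degree a = n" "degree b = n" for a b n
    using that
  proof (induction n arbitrary: a b)
    case 0
    then have "a = 1" "b = 1" by (auto elim!: degree_eq_zeroE simp: one_pCons)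
    with \<open>P 1\<close> show ?case by (simp add: fract_collapse)
  next
    case (Suc n)
    obtain z a' where a': "a = [:- z, 1:] * a'" "lead_coeff a' = 1" "degree a' = n"
      using Suc.prems(1,3) by (rule monic_linear_factor)
    obtain y b' where b': "b = [:- y, 1:] * b'" "lead_coeff b' = 1" "degree b' = n"
      using Suc.prems(2,4) by (rule monic_linear_factor)
    show ?case
      using lin[OF Suc.IH[of a' b'], of z y] a' b' by (simp add: lin_frac_def)
  qed
  obtain a b where r: "r = Fract a b" "b \<noteq> 0" by (cases r) auto
  have "a \<noteq> 0" using val_inf_neq_0[OF assms(1)] r by (auto simp: fract_collapse)
  with r assms(1) have "degree a = degree b \<and> lead_coeff a = 1 * lead_coeff b"
    using val_inf_Fract_iff[of a b 1] by (metis one_neq_zero)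
  then have *: "degree a = degree b" "coeff a (degree b) = lead_coeff b"
    by (metis mult_1)+
  define c where "c = inverse (lead_coeff b)"
  have "c \<noteq> 0" using r by (simp add: c_def)
  then have "r = Fract (smult c a) (smult c b)"
    using r by (simp add: eq_fract)
  also have "P \<dots>"
    using * r \<open>a \<noteq> 0\<close> \<open>c \<noteq> 0\<close> by (intro monic[of _ _ "degree b"]) (simp_all add: c_def)
  finally show ?thesis .
qed

text \<open>Hilbert 90: such an \<open>r\<close> is \<open>s / bar s\<close> for \<open>s = 1 + r\<close>.\<close>

lemma unit_circle_induct [consumes 2, case_names one mult]:
  assumes "val_inf r 1" and "r * bar r = 1"
    and "P 1" and lin: "\<And>\<alpha> r. P r \<Longrightarrow> P (lin_frac \<alpha> (cnj \<alpha>) * r)"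
  shows "P r"
proof -
  have monic: "P (Fract b (map_poly cnj b))"
    if "lead_coeff b = 1" "degree b = n" for b n
    using that
  proof (induction n arbitrary: b)
    case 0
    then have "b = 1" by (auto elim!: degree_eq_zeroE simp: one_pCons)
    with \<open>P 1\<close> show ?case by (simp add: fract_collapse map_poly_1')
  next
    case (Suc n)
    obtain z b' where b': "b = [:- z, 1:] * b'" "lead_coeff b' = 1" "degree b' = n"
      using Suc.prems by (rule monic_linear_factor)
    have "map_poly cnj b = [:- cnj z, 1:] * map_poly cnj b'"
      unfolding b'(1) map_poly_cnj_mult by (simp add: map_poly_pCons)
    with lin[OF Suc.IH[of b'], of z] b' show ?case
      by (simp add: lin_frac_def del: mult_pCons_left)
  qed
  have v: "val_inf (1 + r) 2" using val_inf_add[OF val_inf_1 assms(1)] by simp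
  have nz: "1 + r \<noteq> 0" using val_inf_neq_0[OF v] by simp
  then have nz': "1 + bar r \<noteq> 0" using bar_eq_0_iff[of "1 + r"] by simp
  obtain c d where cd: "1 + r = Fract c d" "d \<noteq> 0" by (cases "1 + r") auto
  have "c \<noteq> 0" using cd nz by (auto simp: fract_collapse)
  \<comment> \<open>With \<open>s = c / d\<close> the quotient \<open>s / bar s\<close> clears to
    the polynomial \<open>b\<close> over its own conjugate.\<close>
  define b where "b = c * map_poly cnj d"
  have "b \<noteq> 0" using \<open>c \<noteq> 0\<close> cd by (simp add: b_def map_poly_cnj_eq_0_iff)
  have "r = (1 + r) / bar (1 + r)"
    using nz' assms(2) by (simp add: field_simps)
  also have "\<dots> = Fract b (map_poly cnj b)"
    unfolding cd(1) cnj_ratfun_Fract[OF cd(2)] divide_fract b_def map_poly_cnj_mult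
    by (simp add: map_poly_map_poly o_def mult.commute)
  finally have r: "r = Fract b (map_poly cnj b)" .
  with assms(1) \<open>b \<noteq> 0\<close> have "lead_coeff b = lead_coeff (map_poly cnj b)"
    using val_inf_Fract_iff[of b "map_poly cnj b" 1] by (metis map_poly_cnj_eq_0_iff mult_1 one_neq_zero)
  \<comment> \<open>A real leading coefficient permits making \<open>b\<close> monic while the
    denominator stays conjugate to the numerator.\<close>
  then have real: "cnj (lead_coeff b) = lead_coeff b"
    by (simp add: coeff_map_poly degree_map_poly)
  define k where "k = inverse (lead_coeff b)"
  have "k \<noteq> 0" using \<open>b \<noteq> 0\<close> by (simp add: k_def)
  have "map_poly cnj (smult k b) = smult k (map_poly cnj b)"
    using real by (intro poly_eqI) (simp add: coeff_map_poly k_def)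
  then have "r = Fract (smult k b) (map_poly cnj (smult k b))"
    using r \<open>k \<noteq> 0\<close> \<open>b \<noteq> 0\<close> by (simp add: eq_fract map_poly_cnj_eq_0_iff)
  also have "P \<dots>"
    using \<open>b \<noteq> 0\<close> by (intro monic[OF _ refl]) (simp add: k_def)
  finally show ?thesis .
qed

section \<open>Isometries over the rational functions\<close>

definition sg :: "'a + 'b \<Rightarrow> 'c::ring_1" where
  "sg i = (case i of Inl _ \<Rightarrow> - 1 | Inr _ \<Rightarrow> 1)"

lemma sg_simps [simp]: "sg (Inl a) = - 1" "sg (Inr b) = 1"
  by (simp_all add: sg_def)

lemma sg_sg [simp]: "sg i * sg i = 1" "sg i * (sg i * x) = x"
  by (cases i; simp)+

lemma bar_sg [simp]: "bar (sg i) = sg i"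
  by (cases i) simp_all

lemma cnj_sg [simp]: "cnj (sg i) = sg i"
  by (cases i) simp_all

lemma cst_sg [simp]: "cst (sg i) = sg i"
  by (cases i) simp_all

lemma sg_neq_0 [simp]: "sg i \<noteq> (0 :: 'c::ring_1)"
  by (cases i) simp_all

lemma herm_altdef: "herm v w = (\<Sum>i\<in>UNIV. sg i * cnj (v $ i) * w $ i)"
  unfolding herm_def UNIV_Plus_UNIV[symmetric] Plus_def
  by (subst sum.union_disjoint) (auto simp: sum.reindex sum_negf)

lemma herm_simps:
  "herm (x + y) z = herm x z + herm y z" "herm z (x + y) = herm z x + herm z y"
  "herm (x - y) z = herm x z - herm y z" "herm z (x - y) = herm z x - herm z y"
  "herm (c *s x) z = cnj c * herm x z" "herm z (c *s x) = c * herm z x"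
  by (simp_all add: herm_altdef algebra_simps sum.distrib sum_subtractf sum_distrib_left)

lemma cnj_herm [simp]: "cnj (herm x y) = herm y x"
  by (simp add: herm_altdef algebra_simps)

text \<open>The extension of \<open>herm\<close> to rational vectors, sesquilinear with respect to
  \<open>bar\<close>. The reality condition will be restated in terms of its isometries.\<close>

definition hform :: "ratfun^('p::finite + 'q::finite) \<Rightarrow> ratfun^('p + 'q) \<Rightarrow> ratfun" where
  "hform x y = (\<Sum>i\<in>UNIV. sg i * bar (x $ i) * y $ i)"

lemma hform_simps:
  "hform (x + y) z = hform x z + hform y z" "hform z (x + y) = hform z x + hform z y"
  "hform (x - y) z = hform x z - hform y z" "hform z (x - y) = hform z x - hform z y"
  "hform (c *s x) z = bar c * hform x z" "hform z (c *s x) = c * hform z x"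
  by (simp_all add: hform_def algebra_simps sum.distrib sum_subtractf sum_distrib_left)

lemma bar_hform [simp]: "bar (hform x y) = hform y x"
  by (simp add: hform_def algebra_simps bar_sum)

lemma hform_axis [simp]: "hform (axis i c) y = sg i * bar c * y $ i"
  "hform y (axis i c) = sg i * bar (y $ i) * c"
  by (simp_all add: hform_def axis_def if_distrib[of bar] if_distrib[of "\<lambda>x. _ * x"] if_distrib[of "\<lambda>x. x * _"]
      cong: if_cong)

lemma hform_nondegenerate:
  assumes "\<And>x. hform x y = hform x z" shows "y = z"
proof -
  have "y $ i = z $ i" for i
    using assms[of "axis i 1"] by simp
  then show ?thesis by (simp add: vec_eq_iff)
qed

definition emb :: "complex^'n \<Rightarrow> ratfun^'n" where "emb v = (\<chi> i. cst (v $ i))"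

lemma emb_nth [simp]: "emb v $ i = cst (v $ i)"
  by (simp add: emb_def)

lemma emb_simps [simp]: "emb (x + y) = emb x + emb y" "emb (x - y) = emb x - emb y"
  "emb (c *s x) = cst c *s emb x" "emb (axis i c) = axis i (cst c)"
  by (simp_all add: vec_eq_iff axis_def)

lemma hform_emb: "hform (emb v) (emb w) = cst (herm v w)"
  by (simp add: hform_def herm_altdef cst_sum)

section \<open>Adjoints and the reality condition\<close>

lemma loop_star_nth: "loop_star g $ i $ j = sg i * bar (g $ j $ i) * sg j"
proof -
  have sgm: "sgn_matrix $ i $ j = (if i = j then sg i else 0)" for i j :: "'p::finite + 'q::finite"
    by (simp add: sgn_matrix_def sg_def)
  show ?thesis
    by (simp add: loop_star_def matrix_matrix_mult_def transpose_def sgm if_distrib[of "\<lambda>x. _ * x"]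
        if_distrib[of "\<lambda>x. x * _"] cong: if_cong)
qed

text \<open>The signs flanking the conjugate transpose in \<open>loop_star\<close> turn the adjoint
  for the standard pairing into the one for \<open>hform\<close>.\<close>

lemma hform_adjoint: "hform (g *v x) y = hform x (loop_star g *v y)"
proof -
  have "hform (g *v x) y = (\<Sum>i\<in>UNIV. \<Sum>j\<in>UNIV. sg i * bar (g $ i $ j) * bar (x $ j) * y $ i)"
    by (simp add: hform_def matrix_vector_mult_def bar_sum sum_distrib_left sum_distrib_right mult.assoc)
  also have "\<dots> = (\<Sum>j\<in>UNIV. \<Sum>i\<in>UNIV. sg i * bar (g $ i $ j) * bar (x $ j) * y $ i)"
    by (rule sum.swap)
  also have "\<dots> = hform x (loop_star g *v y)"
    by (simp add: hform_def matrix_vector_mult_def sum_distrib_left loop_star_nth algebra_simps)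
  finally show ?thesis .
qed

lemma loop_star_mult: "loop_star (g ** h) = loop_star h ** loop_star g"
  unfolding matrix_eq
proof
  fix y
  show "loop_star (g ** h) *v y = (loop_star h ** loop_star g) *v y"
    by (rule hform_nondegenerate)
      (simp add: hform_adjoint matrix_vector_mul_assoc[symmetric] flip: hform_adjoint)
qed

lemma loop_star_mat_1: "loop_star (mat 1) = mat 1"
  by (auto simp: vec_eq_iff loop_star_nth mat_def)

definition isometry :: "ratfun^('p::finite + 'q::finite)^('p + 'q) \<Rightarrow> bool" where
  "isometry g \<longleftrightarrow> (\<forall>x y. hform (g *v x) (g *v y) = hform x y)"

lemma isometry_iff_loop_star: "isometry g \<longleftrightarrow> loop_star g ** g = mat 1"
proof
  assume "isometry g"
  then have "hform x (loop_star g *v (g *v y)) = hform x y" for x y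
    by (simp add: isometry_def flip: hform_adjoint)
  then show "loop_star g ** g = mat 1"
    unfolding matrix_eq matrix_vector_mul_assoc[symmetric] matrix_vector_mul_lid
    by (intro allI hform_nondegenerate)
qed (simp add: isometry_def hform_adjoint matrix_vector_mul_assoc)

definition tends_to_1 :: "ratfun^'n^'n \<Rightarrow> bool" where
  "tends_to_1 g \<longleftrightarrow> (\<forall>i j. val_inf (g $ i $ j) (mat 1 $ i $ j))"

lemma matrix_inv_eqI:
  fixes A B :: "'a::field^'n^'n"
  assumes "A ** B = mat 1" shows "matrix_inv A = B"
proof -
  have BA: "B ** A = mat 1" using assms by (simp add: matrix_left_right_inverse)
  show ?thesis
    unfolding matrix_inv_def
  proof (rule some_equality)
    show "C = B" if "A ** C = mat 1 \<and> C ** A = mat 1" for C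
      using that BA by (metis matrix_mul_assoc matrix_mul_lid matrix_mul_rid)
  qed (use assms BA in simp)
qed

text \<open>For invertible \<open>g\<close> the reality condition says that \<open>g\<close> is
  inverse to its adjoint. Conversely, multiplicativity of determinants gives an isometry a nonzero
  determinant.\<close>

lemma LU_iff: "g \<in> LU \<longleftrightarrow> tends_to_1 g \<and> isometry g"
proof -
  have "det g \<noteq> 0 \<and> matrix_inv (loop_star g) = g \<longleftrightarrow> loop_star g ** g = mat 1"
  proof
    assume *: "loop_star g ** g = mat 1"
    then have "det (loop_star g) * det g = 1" by (simp flip: det_mul)
    with matrix_inv_eqI[OF *] show "det g \<noteq> 0 \<and> matrix_inv (loop_star g) = g" by auto
  next
    assume *: "det g \<noteq> 0 \<and> matrix_inv (loop_star g) = g"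
    \<comment> \<open>Invertibility passes from \<open>g\<close> to its adjoint, so
      \<open>matrix_inv\<close>, which is defined by choice, does return an inverse here.\<close>
    then obtain h where "g ** h = mat 1"
      by (metis invertible_det_nz invertible_def)
    then have "loop_star h ** loop_star g = mat 1"
      by (metis loop_star_mult loop_star_mat_1)
    then have "loop_star g ** loop_star h = mat 1"
      by (simp add: matrix_left_right_inverse)
    then show "loop_star g ** g = mat 1"
      using * matrix_inv_eqI by metis
  qed
  then show ?thesis
    unfolding isometry_iff_loop_star by (auto simp: LU_def LGL_def tends_to_1_def)
qed

lemma tends_to_1_mat_1: "tends_to_1 (mat 1)"
  by (simp add: tends_to_1_def mat_def)

lemma tends_to_1_mult:
  assumes "tends_to_1 g" "tends_to_1 h" shows "tends_to_1 (g ** h)"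
proof -
  have "val_inf ((g ** h) $ i $ j) ((mat 1 ** mat 1) $ i $ j)" for i j
    unfolding matrix_matrix_mult_def vec_lambda_beta using assms
    by (intro val_inf_sum val_inf_mult) (auto simp: tends_to_1_def)
  then show ?thesis by (simp add: tends_to_1_def)
qed

lemma LU_mult: "g \<in> LU \<Longrightarrow> h \<in> LU \<Longrightarrow> g ** h \<in> LU"
  by (auto simp: LU_iff tends_to_1_mult isometry_def simp flip: matrix_vector_mul_assoc)

section \<open>Scalings and boosts as perturbations of the identity\<close>

definition rank1 :: "ratfun^('p::finite + 'q::finite) \<Rightarrow> ratfun^('p + 'q) \<Rightarrow> ratfun^('p + 'q)^('p + 'q)"
  where "rank1 a b = (\<chi> i j. a $ i * (sg j * bar (b $ j)))"

lemma rank1_mult [simp]: "rank1 a b *v x = hform b x *s a"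
  by (simp add: vec_eq_iff rank1_def matrix_vector_mult_def hform_def sum_distrib_left
      sum_distrib_right mult_ac)

text \<open>When \<open>herm v v\<close> is nonzero, this multiplies the line of \<open>v\<close> by
  \<open>r\<close> and fixes its orthogonal complement.\<close>

definition scaling :: "ratfun \<Rightarrow> complex^('p::finite + 'q::finite) \<Rightarrow> ratfun^('p + 'q)^('p + 'q)" where
  "scaling r v = mat 1 + rank1 (((r - 1) / cst (herm v v)) *s emb v) (emb v)"

text \<open>For isotropic \<open>u\<close>, \<open>w\<close> with pairing \<open>1\<close>, this
  multiplies \<open>u\<close> by \<open>r\<close> and \<open>w\<close> by \<open>1 / bar r\<close>
  and fixes all vectors orthogonal to both. The second factor is forced by invariance of the pairing
  of \<open>u\<close> and \<open>w\<close>.\<close>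

definition boost ::
    "ratfun \<Rightarrow> complex^('p::finite + 'q::finite) \<Rightarrow> complex^('p + 'q) \<Rightarrow> ratfun^('p + 'q)^('p + 'q)" where
  "boost r u w = mat 1 + rank1 ((r - 1) *s emb u) (emb w) + rank1 ((1 / bar r - 1) *s emb w) (emb u)"

lemma scaling_mult:
  "scaling r v *v x = x + ((r - 1) / cst (herm v v) * hform (emb v) x) *s emb v"
  by (simp add: scaling_def matrix_vector_mult_add_rdistrib vec_eq_iff algebra_simps)

lemma boost_mult:
  "boost r u w *v x = x + ((r - 1) * hform (emb w) x) *s emb u
      + ((1 / bar r - 1) * hform (emb u) x) *s emb w"
  by (simp add: boost_def matrix_vector_mult_add_rdistrib vec_eq_iff algebra_simps)

lemma scaling_1 [simp]: "scaling 1 v = mat 1" and boost_1 [simp]: "boost 1 u w = mat 1"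
  by (simp_all add: matrix_eq scaling_mult boost_mult)

lemma scaling_scaling:
  assumes "herm v v \<noteq> 0"
  shows "scaling r v ** scaling s v = scaling (r * s) v"
  unfolding matrix_eq using assms
  by (simp add: scaling_mult hform_simps hform_emb vec_eq_iff field_simps flip: matrix_vector_mul_assoc)

lemma isometry_scaling:
  assumes "herm v v \<noteq> 0" "r * bar r = 1"
  shows "isometry (scaling r v)"
proof -
  have "r \<noteq> 0" using assms(2) by auto
  then have r: "bar r = 1 / r" "r \<noteq> 0" using assms(2) by (simp_all add: field_simps)
  have "hform (scaling r v *v x) (scaling r v *v y) = hform x y" for x y
    using assms(1) r(2) bar_hform[of "emb v" x]
    by (simp add: scaling_mult hform_simps hform_emb r field_simps del: bar_hform)
  then show ?thesis by (simp add: isometry_def)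
qed

lemma tends_to_1_scaling:
  assumes "herm v v \<noteq> 0" "val_inf r 1"
  shows "tends_to_1 (scaling r v)"
proof -
  have "val_inf (scaling r v $ i $ j) (mat 1 $ i $ j)" for i j
  proof -
    \<comment> \<open>The limit is the entry with \<open>r\<close> replaced by its value
      \<open>1\<close>, which makes the correction vanish; signs are read as constants so that the
      value rules apply.\<close>
    have "val_inf (scaling r v $ i $ j)
        (mat 1 $ i $ j + (1 - 1) / herm v v * v $ i * (sg j * cnj (v $ j)))"
      unfolding scaling_def rank1_def vector_add_component vec_lambda_beta vector_smult_component
        emb_nth bar_cst cst_sg[symmetric] cst_simps(6)[symmetric]
      by (intro val_inf_add val_inf_mult val_inf_divide val_inf_diff val_inf_cst assms)
        (auto simp: mat_def)
    then show ?thesis by simp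
  qed
  then show ?thesis by (simp add: tends_to_1_def)
qed

lemma tends_to_1_boost:
  assumes "val_inf r 1"
  shows "tends_to_1 (boost r u w)"
proof -
  have "val_inf (boost r u w $ i $ j) (mat 1 $ i $ j)" for i j
  proof -
    have "val_inf (boost r u w $ i $ j)
        (mat 1 $ i $ j + (1 - 1) * u $ i * (sg j * cnj (w $ j))
          + (1 / cnj 1 - 1) * w $ i * (sg j * cnj (u $ j)))"
      unfolding boost_def rank1_def vector_add_component vec_lambda_beta vector_smult_component
        emb_nth bar_cst cst_sg[symmetric] cst_simps(6)[symmetric]
      by (intro val_inf_add val_inf_mult val_inf_divide val_inf_diff val_inf_cst val_inf_bar val_inf_1 assms)
        (auto simp: mat_def)
    then show ?thesis by simp
  qed
  then show ?thesis by (simp add: tends_to_1_def)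
qed

text \<open>Pairing \<open>1\<close> is a normalisation: two isotropic lines that are not orthogonal
  always contain such a pair.\<close>

definition hyperbolic :: "complex^('p::finite + 'q::finite) \<Rightarrow> complex^('p + 'q) \<Rightarrow> bool" where
  "hyperbolic u w \<longleftrightarrow> herm u u = 0 \<and> herm w w = 0 \<and> herm u w = 1"

lemma hyperbolic_herm:
  assumes "hyperbolic u w"
  shows "herm u u = 0" "herm w w = 0" "herm u w = 1" "herm w u = 1"
  using assms cnj_herm[of u w] by (auto simp: hyperbolic_def simp del: cnj_herm)

lemma boost_boost:
  assumes "hyperbolic u w" "r \<noteq> 0" "s \<noteq> 0"
  shows "boost r u w ** boost s u w = boost (r * s) u w"
  unfolding matrix_eq using assms hyperbolic_herm[OF assms(1)]
  by (simp add: boost_mult hform_simps hform_emb vec_eq_iff field_simps flip: matrix_vector_mul_assoc)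

lemma isometry_boost:
  assumes "hyperbolic u w" "r \<noteq> 0"
  shows "isometry (boost r u w)"
proof -
  have "hform (boost r u w *v x) (boost r u w *v y) = hform x y" for x y
    using assms(2) bar_hform[of "emb u" x] bar_hform[of "emb w" x]
    by (simp add: boost_mult hform_simps hform_emb hyperbolic_herm[OF assms(1)] field_simps
        del: bar_hform)
  then show ?thesis by (simp add: isometry_def)
qed

lemma scaling_in_LU: "herm v v \<noteq> 0 \<Longrightarrow> val_inf r 1 \<Longrightarrow> r * bar r = 1 \<Longrightarrow> scaling r v \<in> LU"
  by (simp add: LU_iff tends_to_1_scaling isometry_scaling)

lemma boost_in_LU: "hyperbolic u w \<Longrightarrow> val_inf r 1 \<Longrightarrow> boost r u w \<in> LU"
  using val_inf_neq_0[of r 1] by (simp add: LU_iff tends_to_1_boost isometry_boost)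

section \<open>The simple elements and the group they generate\<close>

lemma lin_frac_swap [simp]: "lin_frac \<alpha> \<beta> * lin_frac \<beta> \<alpha> = 1"
  using right_inverse[OF lin_frac_neq_0, of \<alpha> \<beta>] by simp

section \<open>Lines, orthogonal complements and projections\<close>

definition line :: "complex^'n \<Rightarrow> (complex^'n) set" where "line v = range (\<lambda>c. c *s v)"

lemma line_mem [simp]: "c *s v \<in> line v" "v \<in> line v" "0 \<in> line v"
  unfolding line_def by (auto intro: range_eqI[of _ _ 1] range_eqI[of _ _ 0])

lemma line_scale:
  assumes "c \<noteq> 0" shows "line (c *s v) = line v"
proof (intro equalityI subsetI)
  fix x assume "x \<in> line (c *s v)"
  then obtain d where "x = d *s (c *s v)" unfolding line_def by blast
  then have "x = (d * c) *s v" by simp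
  then show "x \<in> line v" by (simp only: line_mem)
next
  fix x assume "x \<in> line v"
  then obtain d where "x = d *s v" unfolding line_def by blast
  then have "x = (d / c) *s (c *s v)" using assms by simp
  then show "x \<in> line (c *s v)" by (simp only: line_mem)
qed

lemma complex_line_iff: "complex_line L \<longleftrightarrow> (\<exists>v. v \<noteq> 0 \<and> L = line v)"
proof
  assume L: "complex_line L"
  obtain B where B: "B \<subseteq> L" "vec.independent B" "L \<subseteq> vec.span B" "card B = vec.dim L"
    using vec.basis_exists by blast
  then obtain v where v: "B = {v}"
    using L by (auto simp: complex_line_def card_1_singleton_iff)
  have "L = vec.span B"
    using B L vec.span_minimal[of B L] by (auto simp: complex_line_def)
  moreover have "v \<noteq> 0" using B(2) v by (metis vec.dependent_zero insertI1)
  ultimately show "\<exists>v. v \<noteq> 0 \<and> L = line v"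
    using v by (auto simp: vec.span_singleton line_def)
next
  assume "\<exists>v. v \<noteq> 0 \<and> L = line v"
  then obtain v where "v \<noteq> 0" "L = vec.span {v}"
    by (auto simp: vec.span_singleton line_def)
  then show "complex_line L"
    by (simp add: complex_line_def vec.dim_span)
qed

lemma isotropic_line [simp]: "isotropic (line v) \<longleftrightarrow> herm v v = 0"
proof
  show "isotropic (line v) \<Longrightarrow> herm v v = 0"
    unfolding isotropic_def using line_mem(2) by blast
qed (auto simp: isotropic_def line_def herm_simps)

lemma perp_line: "w \<in> perp (line v) \<longleftrightarrow> herm v w = 0"
  using line_mem(2)[of v] by (auto simp: perp_def line_def herm_simps)

lemma lines_nonorthogonal_line:
  assumes "u \<noteq> 0" "w \<noteq> 0"
  shows "lines_nonorthogonal (line u) (line w) \<longleftrightarrow> herm u w \<noteq> 0"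
proof
  show "lines_nonorthogonal (line u) (line w) \<Longrightarrow> herm u w \<noteq> 0"
    unfolding lines_nonorthogonal_def using assms line_mem(2) by blast
qed (auto simp: lines_nonorthogonal_def line_def herm_simps)

lemma proj_eqI:
  assumes "\<And>x a. a \<in> A \<and> x - a \<in> B \<longleftrightarrow> a = f x"
  shows "proj A B = matrix f"
  using assms by (simp add: proj_def)

lemma matrix_nth: "matrix f $ i $ j = f (axis j 1) $ i"
  by (simp add: matrix_def)

lemma herm_axis [simp]: "herm (axis i c) y = sg i * cnj c * y $ i"
  "herm y (axis i c) = sg i * cnj (y $ i) * c"
  by (simp_all add: herm_altdef axis_def if_distrib[of cnj] if_distrib[of "\<lambda>x. _ * x"]
      if_distrib[of "\<lambda>x. x * _"] cong: if_cong)

lemma scale_loop_nth: "scale_loop r A $ i $ j = r * cst (A $ i $ j)"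
  by (simp add: scale_loop_def cst_def)

lemma cst_axis: "cst (axis j 1 $ i) = mat 1 $ i $ j"
  by (simp add: axis_def mat_def)

lemma one_divide_lin_frac: "1 / lin_frac \<alpha> \<beta> = lin_frac \<beta> \<alpha>"
  using inverse_lin_frac[of \<alpha> \<beta>] by (simp only: inverse_eq_divide)

text \<open>The component of \<open>x\<close> along \<open>v\<close> is
  \<open>herm v x / herm v v\<close> times \<open>v\<close>. The two projections add up to the
  identity, so the loop is the identity plus a multiple of the first.\<close>

lemma p_loop_line:
  assumes "herm v v \<noteq> 0"
  shows "p_loop \<alpha> (line v) = scaling (lin_frac \<alpha> (cnj \<alpha>)) v"
proof -
  have 1: "proj (line v) (perp (line v)) = matrix (\<lambda>x. (herm v x / herm v v) *s v)"
  proof (intro proj_eqI iffI)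
    fix x a assume *: "a \<in> line v \<and> x - a \<in> perp (line v)"
    then obtain c where a: "a = c *s v" by (auto simp: line_def)
    with * have "herm v x = c * herm v v" by (simp add: perp_line herm_simps)
    with assms show "a = (herm v x / herm v v) *s v" by (simp add: a)
  qed (use assms in \<open>simp add: perp_line herm_simps\<close>)
  have 2: "proj (perp (line v)) (line v) = matrix (\<lambda>x. x - (herm v x / herm v v) *s v)"
  proof (intro proj_eqI iffI)
    fix x a assume *: "a \<in> perp (line v) \<and> x - a \<in> line v"
    then obtain c where c: "x - a = c *s v" by (auto simp: line_def)
    then have x: "x = a + c *s v" by (simp add: algebra_simps)
    from * assms show "a = x - (herm v x / herm v v) *s v"
      unfolding x by (simp add: perp_line herm_simps)
  qed (use assms in \<open>auto simp: perp_line herm_simps\<close>)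
  show ?thesis
    unfolding p_loop_def 1 2
    by (simp add: vec_eq_iff scale_loop_nth scaling_def rank1_def matrix_nth cst_axis)
      (simp add: algebra_simps diff_divide_distrib)
qed

lemma sum_spaceI: "a \<in> A \<Longrightarrow> b \<in> B \<Longrightarrow> x = a + b \<Longrightarrow> x \<in> sum_space A B"
  by (auto simp: sum_space_def)

lemma sum_spaceE:
  assumes "x \<in> sum_space A B" obtains a b where "a \<in> A" "b \<in> B" "x = a + b"
  using assms by (auto simp: sum_space_def)

lemma lineE:
  assumes "x \<in> line v" obtains c where "x = c *s v"
  using assms by (auto simp: line_def)

context
  fixes u w :: "complex^('p::finite + 'q::finite)"
  assumes hyp: "hyperbolic u w"
begin

text \<open>Pairing with \<open>w\<close> annihilates \<open>w\<close> and everything orthogonal to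
  both vectors, so it reads off the coefficient of \<open>u\<close>.\<close>

lemma proj_isotropic_line:
  "proj (line u) (sum_space (line w) (perp (line u) \<inter> perp (line w))) = matrix (\<lambda>x. herm w x *s u)"
proof (intro proj_eqI iffI)
  note h = hyperbolic_herm[OF hyp]
  fix x a :: "complex^('p + 'q)"
  {
    assume *: "a \<in> line u \<and> x - a \<in> sum_space (line w) (perp (line u) \<inter> perp (line w))"
    then obtain b y where b: "b \<in> line w" and y: "y \<in> perp (line u) \<inter> perp (line w)"
      and xa: "x - a = b + y" by (blast elim: sum_spaceE)
    obtain c d where a: "a = c *s u" and b: "b = d *s w"
      using * b by (blast elim: lineE)
    have x: "x = d *s w + y + c *s u" using xa unfolding a b by (simp only: diff_eq_eq)
    from y show "a = herm w x *s u" unfolding x a by (simp add: herm_simps h perp_line)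
  }
  assume a: "a = herm w x *s u"
  have "x - herm w x *s u - herm u x *s w \<in> perp (line u) \<inter> perp (line w)"
    by (simp add: perp_line herm_simps h)
  then have "x - a \<in> sum_space (line w) (perp (line u) \<inter> perp (line w))"
    by (rule sum_spaceI[OF line_mem(1)[of "herm u x"]]) (simp add: a)
  then show "a \<in> line u \<and> x - a \<in> sum_space (line w) (perp (line u) \<inter> perp (line w))"
    by (simp add: a)
qed

lemma proj_orthogonal_complement:
  "proj (perp (line u) \<inter> perp (line w)) (sum_space (line u) (line w))
    = matrix (\<lambda>x. x - herm w x *s u - herm u x *s w)"
proof (intro proj_eqI iffI)
  note h = hyperbolic_herm[OF hyp]
  fix x a :: "complex^('p + 'q)"
  {
    assume *: "a \<in> perp (line u) \<inter> perp (line w) \<and> x - a \<in> sum_space (line u) (line w)"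
    then obtain c d where "x - a = c *s u + d *s w" by (blast elim: sum_spaceE lineE)
    then have x: "x = c *s u + d *s w + a" by (simp only: diff_eq_eq)
    from * show "a = x - herm w x *s u - herm u x *s w"
      unfolding x by (simp add: herm_simps h perp_line)
  }
  assume a: "a = x - herm w x *s u - herm u x *s w"
  have "x - a \<in> sum_space (line u) (line w)"
    by (rule sum_spaceI[OF line_mem(1)[of "herm w x"] line_mem(1)[of "herm u x"]]) (simp add: a)
  then show "a \<in> perp (line u) \<inter> perp (line w) \<and> x - a \<in> sum_space (line u) (line w)"
    by (simp add: a perp_line herm_simps h)
qed

end

lemma hyperbolic_sym:
  assumes "hyperbolic u w" shows "hyperbolic w u"
  unfolding hyperbolic_def using hyperbolic_herm[OF assms] by blast

text \<open>The projection onto the complement is the identity minus the two isotropic projections;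
  this turns the loop into the identity plus two terms of rank one.\<close>

lemma g_loop_line:
  assumes "hyperbolic u w"
  shows "g_loop \<alpha> \<beta> (line u) (line w) = boost (lin_frac \<alpha> \<beta>) u w"
proof -
  have 2: "proj (line w) (sum_space (line u) (perp (line u) \<inter> perp (line w))) = matrix (\<lambda>x. herm u x *s w)"
    using proj_isotropic_line[OF hyperbolic_sym[OF assms]] by (simp only: Int_commute)
  let ?r = "lin_frac \<alpha> \<beta>" and ?s = "lin_frac (cnj \<beta>) (cnj \<alpha>)"
  have s: "1 / bar ?r = ?s" by (simp add: one_divide_lin_frac)
  have "g_loop \<alpha> \<beta> (line u) (line w) $ i $ j = boost ?r u w $ i $ j" for i j
  proof -
    have "g_loop \<alpha> \<beta> (line u) (line w) $ i $ j =
      ?r * (sg j * bar (cst (w $ j)) * cst (u $ i)) + ?s * (sg j * bar (cst (u $ j)) * cst (w $ i))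
      + (mat 1 $ i $ j - sg j * bar (cst (w $ j)) * cst (u $ i) - sg j * bar (cst (u $ j)) * cst (w $ i))"
      unfolding g_loop_def Let_def proj_isotropic_line[OF assms] 2 proj_orthogonal_complement[OF assms]
      by (simp add: scale_loop_nth matrix_nth cst_axis)
    also have "\<dots> = boost ?r u w $ i $ j"
      unfolding boost_def s by (simp add: rank1_def ring_distribs)
    finally show ?thesis .
  qed
  then show ?thesis by (simp add: vec_eq_iff)
qed

lemma p_family_eq: "p_family = {scaling (lin_frac \<alpha> (cnj \<alpha>)) v | \<alpha> v. herm v v \<noteq> 0}"
proof (intro equalityI subsetI)
  fix g :: "ratfun^('p::finite + 'q::finite)^('p + 'q)"
  assume "g \<in> p_family"
  then show "g \<in> {scaling (lin_frac \<alpha> (cnj \<alpha>)) v | \<alpha> v. herm v v \<noteq> 0}"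
    by (auto simp: p_family_def complex_line_iff) (metis p_loop_line)
next
  fix g :: "ratfun^('p::finite + 'q::finite)^('p + 'q)"
  assume "g \<in> {scaling (lin_frac \<alpha> (cnj \<alpha>)) v | \<alpha> v. herm v v \<noteq> 0}"
  then obtain \<alpha> v where g: "g = scaling (lin_frac \<alpha> (cnj \<alpha>)) v" "herm v v \<noteq> 0" by blast
  then have "v \<noteq> 0" by (auto simp: herm_altdef)
  then have "complex_line (line v)" "\<not> isotropic (line v)" using g by (auto simp: complex_line_iff)
  moreover have "g = p_loop \<alpha> (line v)" using g by (simp add: p_loop_line)
  ultimately show "g \<in> p_family" unfolding p_family_def by blast
qed

lemma g_family_eq: "g_family = {boost (lin_frac \<alpha> \<beta>) u w | \<alpha> \<beta> u w. hyperbolic u w}"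
proof (intro equalityI subsetI)
  fix g :: "ratfun^('p::finite + 'q::finite)^('p + 'q)"
  assume "g \<in> g_family"
  then obtain \<alpha> \<beta> u w where *: "g = g_loop \<alpha> \<beta> (line u) (line w)" "u \<noteq> 0" "w \<noteq> 0"
    "herm u u = 0" "herm w w = 0" "lines_nonorthogonal (line u) (line w)"
    unfolding g_family_def complex_line_iff by auto
  \<comment> \<open>Rescaling \<open>w\<close> normalises the pairing to \<open>1\<close> without
    changing its line.\<close>
  define w' where "w' = (1 / herm u w) *s w"
  have "hyperbolic u w'"
    using * by (simp add: w'_def hyperbolic_def herm_simps lines_nonorthogonal_line)
  moreover have "line w' = line w"
    using * by (simp add: w'_def line_scale lines_nonorthogonal_line)
  ultimately have "g = boost (lin_frac \<alpha> \<beta>) u w'"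
    using *(1) g_loop_line[of u w' \<alpha> \<beta>] by simp
  with \<open>hyperbolic u w'\<close> show "g \<in> {boost (lin_frac \<alpha> \<beta>) u w | \<alpha> \<beta> u w. hyperbolic u w}" by blast
next
  fix g :: "ratfun^('p::finite + 'q::finite)^('p + 'q)"
  assume "g \<in> {boost (lin_frac \<alpha> \<beta>) u w | \<alpha> \<beta> u w. hyperbolic u w}"
  then obtain \<alpha> \<beta> u w where g: "g = boost (lin_frac \<alpha> \<beta>) u w" "hyperbolic u w" by blast
  note h = hyperbolic_herm[OF g(2)]
  then have nz: "u \<noteq> 0" "w \<noteq> 0" by (auto simp: herm_altdef)
  then have "complex_line (line u)" "complex_line (line w)" "isotropic (line u)"
    "isotropic (line w)" "lines_nonorthogonal (line u) (line w)"
    using h by (auto simp: complex_line_iff lines_nonorthogonal_line)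
  moreover have "g = g_loop \<alpha> \<beta> (line u) (line w)" using g by (simp add: g_loop_line)
  ultimately show "g \<in> g_family" unfolding g_family_def by blast
qed

section \<open>The group generated by the simple elements\<close>

abbreviation (input) simple_group :: "(ratfun^('p::finite + 'q::finite)^('p + 'q)) set" where
  "simple_group \<equiv> generate LGL (p_family \<union> g_family)"

text \<open>Exchanging zero and pole inverts the scalar factor: in \<open>p_family\<close> this
  replaces \<open>\<alpha>\<close> by its conjugate, in \<open>g_family\<close> it swaps
  \<open>\<alpha>\<close> and \<open>\<beta>\<close>.\<close>

lemma family_inverse:
  assumes "g \<in> p_family \<union> g_family"
  shows "\<exists>h\<in>p_family \<union> g_family. g ** h = mat 1 \<and> h ** g = mat 1"
  using assms
proof
  assume "g \<in> p_family"
  then obtain \<alpha> v where g: "g = scaling (lin_frac \<alpha> (cnj \<alpha>)) v" "herm v v \<noteq> 0"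
    unfolding p_family_eq by blast
  have "scaling (lin_frac (cnj \<alpha>) (cnj (cnj \<alpha>))) v \<in> p_family" using g unfolding p_family_eq by blast
  with g show ?thesis
    by (intro bexI[of _ "scaling (lin_frac (cnj \<alpha>) \<alpha>) v"])
      (auto simp: scaling_scaling)
next
  assume "g \<in> g_family"
  then obtain \<alpha> \<beta> u w where g: "g = boost (lin_frac \<alpha> \<beta>) u w" "hyperbolic u w"
    unfolding g_family_eq by blast
  have "boost (lin_frac \<beta> \<alpha>) u w \<in> g_family" using g unfolding g_family_eq by blast
  with g show ?thesis
    by (intro bexI[of _ "boost (lin_frac \<beta> \<alpha>) u w"])
      (auto simp: boost_boost)
qed

lemma family_subset_LU: "p_family \<union> g_family \<subseteq> LU"
  by (auto simp: p_family_eq g_family_eq scaling_in_LU boost_in_LU)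

lemma inv_family:
  assumes "g \<in> p_family \<union> g_family"
  shows "m_inv LGL g \<in> p_family \<union> g_family"
proof -
  obtain h where h: "h \<in> p_family \<union> g_family" "g ** h = mat 1" "h ** g = mat 1"
    using family_inverse[OF assms] by blast
  have "m_inv LGL g = h"
    unfolding m_inv_def
  proof (rule the_equality)
    have "h \<in> carrier LGL" using h(1) family_subset_LU by (auto simp: LU_def)
    then show "h \<in> carrier LGL \<and> g \<otimes>\<^bsub>LGL\<^esub> h = \<one>\<^bsub>LGL\<^esub> \<and> h \<otimes>\<^bsub>LGL\<^esub> g = \<one>\<^bsub>LGL\<^esub>"
      using h by (simp add: LGL_def)
    show "k = h" if "k \<in> carrier LGL \<and> g \<otimes>\<^bsub>LGL\<^esub> k = \<one>\<^bsub>LGL\<^esub> \<and> k \<otimes>\<^bsub>LGL\<^esub> g = \<one>\<^bsub>LGL\<^esub>" for k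
      using that h by (simp add: LGL_def) (metis matrix_mul_assoc matrix_mul_lid matrix_mul_rid)
  qed
  with h show ?thesis by simp
qed

lemma simple_group_one: "mat 1 \<in> simple_group"
  using generate.one[of LGL] by (simp add: LGL_def)

lemma simple_group_mult: "g \<in> simple_group \<Longrightarrow> h \<in> simple_group \<Longrightarrow> g ** h \<in> simple_group"
  using generate.eng[of g LGL _ h] by (simp add: LGL_def)

text \<open>\<open>generate\<close> also admits inverses of generators; as the families are closed
  under inversion, that case merges with the one for generators.\<close>

lemma simple_group_induct [consumes 1, case_names one family mult]:
  assumes "g \<in> simple_group"
    and "P (mat 1)" and "\<And>g. g \<in> p_family \<union> g_family \<Longrightarrow> P g"
    and "\<And>g h. P g \<Longrightarrow> P h \<Longrightarrow> P (g ** h)"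
  shows "P g"
  using assms(1)
proof (induction rule: generate.induct)
  case one then show ?case using assms(2) by (simp add: LGL_def)
next
  case (incl h) then show ?case by (rule assms(3))
next
  case (inv h) then show ?case by (intro assms(3) inv_family)
next
  case (eng g h) then show ?case using assms(4) by (simp add: LGL_def)
qed

lemma simple_group_subset_LU: "g \<in> simple_group \<Longrightarrow> g \<in> LU"
proof (induction rule: simple_group_induct)
  case one show ?case by (simp add: LU_iff tends_to_1_mat_1 isometry_def)
next
  case (family g) then show ?case using family_subset_LU by blast
next
  case (mult g h) then show ?case by (rule LU_mult)
qed

lemma simple_group_inverse:
  "g \<in> simple_group \<Longrightarrow> \<exists>h\<in>simple_group. h ** g = mat 1"
proof (induction rule: simple_group_induct)
  case one show ?case using simple_group_one by (intro bexI[of _ "mat 1"]) auto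
next
  case (family g) then show ?case using family_inverse generate.incl by metis
next
  case (mult g h)
  then obtain g' h' where *: "g' \<in> simple_group" "g' ** g = mat 1" "h' \<in> simple_group" "h' ** h = mat 1"
    by blast
  have "(h' ** g') ** (g ** h) = mat 1"
    using * by (metis matrix_mul_assoc matrix_mul_lid)
  with * show ?case using simple_group_mult by blast
qed

text \<open>Boosts along a fixed pair are multiplicative in \<open>r\<close>, and \<open>r\<close>
  is a product of factors \<open>lin_frac\<close>, each of which gives a member of
  \<open>g_family\<close>.\<close>

lemma boost_in_simple_group:
  assumes "hyperbolic u w" "val_inf r 1"
  shows "boost r u w \<in> simple_group"
proof -
  have "r \<noteq> 0 \<and> boost r u w \<in> simple_group"
    using assms(2)
  proof (induction rule: val_inf_1_induct)
    case (mult \<alpha> \<beta> r)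
    have "boost (lin_frac \<alpha> \<beta>) u w \<in> simple_group"
      using assms(1) by (intro generate.incl) (auto simp: g_family_eq)
    from simple_group_mult[OF this, of "boost r u w"] mult show ?case
      by (simp add: boost_boost[OF assms(1)])
  qed (simp add: simple_group_one)
  then show ?thesis ..
qed

text \<open>Multiplicativity again, now with the factorization from Hilbert 90, whose factors
  \<open>lin_frac \<alpha> (cnj \<alpha>)\<close> give members of \<open>p_family\<close>.\<close>

lemma scaling_in_simple_group:
  assumes "herm v v \<noteq> 0" "val_inf r 1" "r * bar r = 1"
  shows "scaling r v \<in> simple_group"
  using assms(2,3)
proof (induction rule: unit_circle_induct)
  case (mult \<alpha> r)
  have "scaling (lin_frac \<alpha> (cnj \<alpha>)) v \<in> simple_group"
    using assms(1) by (intro generate.incl) (auto simp: p_family_eq)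
  from simple_group_mult[OF this mult] show ?case
    by (simp add: scaling_scaling[OF assms(1)])
qed (simp add: simple_group_one)

section \<open>Elimination\<close>

lemma axis_nth_if: "axis i c $ k = (if k = i then c else 0)"
  by (simp add: axis_def)

lemma numeral_ratfun_neq_0 [simp]: "(numeral n :: ratfun) \<noteq> 0"
  unfolding cst_numeral[symmetric] cst_simps by simp

lemma matrix_axis_nth: "(g *v axis j 1) $ i = g $ i $ j"
  by (simp add: matrix_vector_mult_def axis_def if_distrib[of "\<lambda>x. _ * x"] cong: if_cong)

lemma matrix_eq_axisI:
  assumes "\<And>j. g *v axis j 1 = h *v axis j 1" shows "g = h"
  using assms matrix_axis_nth[of g] matrix_axis_nth[of h] by (metis vec_eq_iff)

lemma tends_to_1_val_inf:
  fixes v :: "ratfun^'n" and c :: "complex^'n"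
  assumes "tends_to_1 g" "\<And>l. val_inf (v $ l) (c $ l)"
  shows "val_inf ((g *v v) $ l) (c $ l)"
proof -
  have "val_inf ((g *v v) $ l) ((mat 1 *v c) $ l)"
    unfolding matrix_vector_mult_def vec_lambda_beta using assms
    by (intro val_inf_sum val_inf_mult) (auto simp: tends_to_1_def)
  then show ?thesis by simp
qed

definition acts_on :: "'n set \<Rightarrow> ratfun^'n^'n \<Rightarrow> bool" where
  "acts_on S g \<longleftrightarrow> (\<forall>k. k \<notin> S \<longrightarrow> g *v axis k 1 = axis k 1)"

text \<open>Up to sign, coordinate \<open>k\<close> is the pairing with \<open>axis k 1\<close>,
  which \<open>g\<close> fixes. So \<open>g\<close> also maps the span of the basis vectors in
  \<open>S\<close> to itself.\<close>

lemma acts_on_nth: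
  assumes "isometry g" "acts_on S g" "k \<notin> S"
  shows "(g *v x) $ k = x $ k"
proof -
  have "hform (axis k 1) (g *v x) = hform (g *v axis k 1) (g *v x)"
    using assms by (simp add: acts_on_def)
  also have "\<dots> = hform (axis k 1) x" using assms(1) unfolding isometry_def by blast
  finally show ?thesis by simp
qed

lemma acts_on_mult: "acts_on S g \<Longrightarrow> acts_on S h \<Longrightarrow> acts_on S (g ** h)"
  by (simp add: acts_on_def flip: matrix_vector_mul_assoc)

lemma acts_on_boost:
  assumes "\<And>k. k \<notin> S \<Longrightarrow> u $ k = 0" "\<And>k. k \<notin> S \<Longrightarrow> w $ k = 0"
  shows "acts_on S (boost r u w)"
  using assms by (simp add: acts_on_def boost_mult)

definition simple_group_on :: "('p + 'q) set \<Rightarrow> (ratfun^('p::finite + 'q::finite)^('p + 'q)) set" where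
  "simple_group_on S = {g \<in> simple_group. acts_on S g}"

lemma simple_group_on_mult:
  "g \<in> simple_group_on S \<Longrightarrow> h \<in> simple_group_on S \<Longrightarrow> g ** h \<in> simple_group_on S"
  by (simp add: simple_group_on_def simple_group_mult acts_on_mult)

lemma mat_1_in_simple_group_on: "mat 1 \<in> simple_group_on S"
  by (simp add: simple_group_on_def simple_group_one acts_on_def)

lemma simple_group_on_isometry: "g \<in> simple_group_on S \<Longrightarrow> isometry g"
  using simple_group_subset_LU by (auto simp: simple_group_on_def LU_iff)

lemma simple_group_on_tends_to_1: "g \<in> simple_group_on S \<Longrightarrow> tends_to_1 g"
  using simple_group_subset_LU by (auto simp: simple_group_on_def LU_iff)

section \<open>Boosts in a coordinate subspace and their quotients\<close>

lemma boost_in_simple_group_on: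
  assumes "hyperbolic u w" "val_inf r 1"
    and "\<And>k. k \<notin> S \<Longrightarrow> u $ k = 0" "\<And>k. k \<notin> S \<Longrightarrow> w $ k = 0"
  shows "boost r u w \<in> simple_group_on S"
  using assms by (simp add: simple_group_on_def boost_in_simple_group acts_on_boost)

text \<open>The quotient of two boosts along the same \<open>u\<close> is unipotent: it is where the loops with a
  nilpotent residue come from.\<close>

lemma boost_quotient:
  assumes "hyperbolic u w" "hyperbolic u w'" "r \<noteq> 0"
  shows "(boost r u w' ** boost (1 / r) u w) *v x =
    x + ((r - 1) * (hform (emb w' - emb w) x
      + (bar r - 1) * hform (emb u) x * cst (herm w' w))) *s emb u
    + ((1 - bar r) * hform (emb u) x) *s (emb w' - emb w)"
  using assms(3) unfolding matrix_vector_mul_assoc[symmetric]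
  by (simp add: boost_mult hform_simps hform_emb hyperbolic_herm[OF assms(1)]
      hyperbolic_herm[OF assms(2)] vec_eq_iff field_simps)

lemma boost_quotient_in_simple_group_on:
  assumes "hyperbolic u w" "hyperbolic u w'" "val_inf r 1"
    and "\<And>k. k \<notin> S \<Longrightarrow> u $ k = 0" "\<And>k. k \<notin> S \<Longrightarrow> w $ k = 0" "\<And>k. k \<notin> S \<Longrightarrow> w' $ k = 0"
  shows "boost r u w' ** boost (1 / r) u w \<in> simple_group_on S"
  using assms val_inf_divide[OF val_inf_1 assms(3)]
  by (intro simple_group_on_mult boost_in_simple_group_on) simp_all

text \<open>Here the two partners of \<open>u\<close> differ by a multiple of \<open>u\<close>
  itself, so the quotient of boosts moves vectors only along \<open>u\<close>.\<close>

lemma transvection: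
  assumes "hyperbolic u w" "val_inf r 1" "cnj c = - c"
    and "\<And>k. k \<notin> S \<Longrightarrow> u $ k = 0" "\<And>k. k \<notin> S \<Longrightarrow> w $ k = 0"
  shows "\<exists>h\<in>simple_group_on S. \<forall>x.
    h *v x = x + (cst c * (1 - r * bar r) * hform (emb u) x) *s emb u"
proof (rule bexI)
  \<comment> \<open>An imaginary \<open>c\<close> keeps this vector isotropic, as the contributions
    \<open>c\<close> and \<open>cnj c\<close> cancel, and leaves its pairing with \<open>u\<close>
    unchanged.\<close>
  let ?w = "w + c *s u"
  have hyp: "hyperbolic u ?w"
    using assms(3) hyperbolic_herm[OF assms(1)] by (simp add: hyperbolic_def herm_simps)
  show "boost r u ?w ** boost (1 / r) u w \<in> simple_group_on S"
    using assms by (intro boost_quotient_in_simple_group_on hyp) auto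
  show "\<forall>x. (boost r u ?w ** boost (1 / r) u w) *v x =
      x + (cst c * (1 - r * bar r) * hform (emb u) x) *s emb u"
    unfolding boost_quotient[OF assms(1) hyp val_inf_neq_0[OF assms(2) one_neq_zero]]
    using assms(3) hyperbolic_herm[OF assms(1)]
    by (simp add: herm_simps hform_simps vec_eq_iff algebra_simps)
qed

section \<open>Moving unit vectors inside an indefinite coordinate subspace\<close>

context
  fixes i j :: "'p::finite + 'q::finite" and S :: "('p + 'q) set" and u w :: "complex^('p + 'q)"
  assumes ij: "(sg j :: complex) = - sg i" "i \<in> S" "j \<in> S"
  defines "u \<equiv> axis i 1 + axis j 1"
  defines "w \<equiv> axis i (sg i / 2) - axis j (sg i / 2)"
begin

lemma ij_neq: "i \<noteq> j" "j \<noteq> i"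
  using ij by (auto simp: eq_neg_iff_add_eq_0)

lemma sg_j: "(sg j :: ratfun) = - sg i"
  using ij(1) by (cases i; cases j) auto

lemma uw_nth: "u $ l = (if l = i \<or> l = j then 1 else 0)"
  "w $ l = (if l = i then sg i / 2 else if l = j then - sg i / 2 else 0)"
  using ij_neq by (simp_all add: u_def w_def axis_nth_if)

text \<open>Opposite signs of the two coordinates make sum and difference isotropic; the factor
  \<open>sg i / 2\<close> normalises the pairing to \<open>1\<close>.\<close>

lemma hyperbolic_uw: "hyperbolic u w"
  using ij_neq unfolding hyperbolic_def u_def w_def
  by (simp add: herm_simps axis_nth_if ij(1))

lemma hform_u: "hform (emb u) x = sg i * (x $ i - x $ j)"
  by (simp add: u_def hform_simps sg_j algebra_simps)

lemma hform_w: "hform (emb w) x = (x $ i + x $ j) / 2"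
  by (simp add: w_def hform_simps sg_j algebra_simps add_divide_distrib)

text \<open>Apart from a multiple of \<open>u\<close>, the quotient of boosts adds
  \<open>(1 - bar r) * hform (emb u) x\<close> times \<open>emb w' - emb w\<close>. If this
  difference has component \<open>1\<close> at \<open>k\<close>, a suitable \<open>r\<close> cancels
  \<open>x $ k\<close>, and only the coordinates \<open>i\<close>, \<open>j\<close>,
  \<open>k\<close> are affected.\<close>

lemma clear_coordinate:
  assumes k: "k \<in> S" "k \<noteq> i" "k \<noteq> j"
    and x: "val_inf (hform (emb u) x) (sg i)" "val_inf (x $ k) 0"
  shows "\<exists>h\<in>simple_group_on S. hform (emb u) (h *v x) = hform (emb u) x \<and> (h *v x) $ k = 0 \<and>
    (\<forall>l. l \<notin> {i, j, k} \<longrightarrow> (h *v x) $ l = x $ l)"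
proof -
  let ?b = "hform (emb u) x"
  \<comment> \<open>Solves \<open>(1 - bar r) * ?b = - (x $ k)\<close>; its value is
    \<open>1\<close> because \<open>x $ k\<close> vanishes at infinity and \<open>?b\<close> does
    not.\<close>
  define r where "r = bar (1 + x $ k / ?b)"
  have "val_inf (1 + x $ k / ?b) 1"
    using val_inf_add[OF val_inf_1 val_inf_divide[OF x(2,1)]] by simp
  from val_inf_bar[OF this] have r: "val_inf r 1" by (simp only: r_def complex_cnj_one)
  have b: "?b \<noteq> 0" using val_inf_neq_0[OF x(1)] by simp
  \<comment> \<open>Adding \<open>axis k 1\<close> contributes norm \<open>sg k\<close>; the
    multiple of \<open>u\<close> compensates for it and keeps \<open>w'\<close> isotropic.\<close>
  define w' where "w' = w + (axis k 1 - (sg k / 2) *s u)"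
  have hyp: "hyperbolic u w'"
    using hyperbolic_herm[OF hyperbolic_uw] k uw_nth
    by (simp add: hyperbolic_def w'_def herm_simps)
  define h where "h = boost r u w' ** boost (1 / r) u w"
  have h: "h \<in> simple_group_on S"
    unfolding h_def using k ij r
    by (intro boost_quotient_in_simple_group_on hyp hyperbolic_uw)
      (auto simp: uw_nth w'_def axis_nth_if)
  have hx: "h *v x = x + ((r - 1) * (hform (emb w' - emb w) x
      + (bar r - 1) * hform (emb u) x * cst (herm w' w))) *s emb u
    + ((1 - bar r) * hform (emb u) x) *s (emb w' - emb w)"
    unfolding h_def
    by (rule boost_quotient[OF hyperbolic_uw hyp val_inf_neq_0[OF r one_neq_zero]])
  have "hform (emb u) (h *v x) = ?b"
    unfolding hx by (simp only: hform_simps hform_emb hyperbolic_herm[OF hyperbolic_uw] hyperbolic_herm[OF hyp]) simp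
  moreover have w'k: "(emb w' - emb w) $ k = 1" "emb u $ k = 0"
    using k by (simp_all add: w'_def uw_nth axis_nth_if)
  then have "(h *v x) $ k = x $ k + (1 - bar r) * ?b"
    unfolding hx vector_add_component vector_smult_component by simp
  then have "(h *v x) $ k = 0" using b by (simp add: r_def)
  moreover have "(h *v x) $ l = x $ l" if "l \<notin> {i, j, k}" for l
  proof -
    have "(emb w' - emb w) $ l = 0" "emb u $ l = 0"
      using that by (simp_all add: w'_def uw_nth axis_nth_if)
    then show ?thesis unfolding hx vector_add_component vector_smult_component by simp
  qed
  ultimately show ?thesis using h by blast
qed

text \<open>Each single clearing preserves the pairing with \<open>u\<close> and the coordinates
  cleared before, so the clearings can be composed.\<close>

lemma clear_coordinates:
  assumes "K \<subseteq> S - {i, j}"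
    and x: "val_inf (hform (emb u) x) (sg i)" "\<And>k. k \<in> K \<Longrightarrow> val_inf (x $ k) 0"
  shows "\<exists>h\<in>simple_group_on S. hform (emb u) (h *v x) = hform (emb u) x \<and>
    (\<forall>l. l \<notin> {i, j} \<longrightarrow> (h *v x) $ l = (if l \<in> K then 0 else x $ l))"
proof -
  have "finite K" by simp
  then show ?thesis
    using assms(1) x(2)
  proof (induction K)
    case empty
    show ?case by (rule bexI[OF _ mat_1_in_simple_group_on]) simp
  next
    case (insert k K)
    then obtain h where h: "h \<in> simple_group_on S" "hform (emb u) (h *v x) = hform (emb u) x"
      "\<And>l. l \<notin> {i, j} \<Longrightarrow> (h *v x) $ l = (if l \<in> K then 0 else x $ l)"
      by auto
    have k: "k \<in> S" "k \<noteq> i" "k \<noteq> j" "k \<notin> K" using insert by auto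
    have "val_inf (hform (emb u) (h *v x)) (sg i)" using h(2) x(1) by simp
    moreover have "val_inf ((h *v x) $ k) 0" using h(3)[of k] k insert.prems(2) by simp
    ultimately obtain h' where h': "h' \<in> simple_group_on S"
      "hform (emb u) (h' *v (h *v x)) = hform (emb u) (h *v x)" "(h' *v (h *v x)) $ k = 0"
      "\<And>l. l \<notin> {i, j, k} \<Longrightarrow> (h' *v (h *v x)) $ l = (h *v x) $ l"
      using clear_coordinate[OF k(1-3)] by blast
    show ?case
    proof (rule bexI)
      show "h' ** h \<in> simple_group_on S" using h h' by (simp add: simple_group_on_mult)
      have "(h' *v (h *v x)) $ l = (if l \<in> insert k K then 0 else x $ l)" if "l \<notin> {i, j}" for l
        using that h'(3) h'(4)[of l] h(3)[of l] by (cases "l = k") auto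
      then show "hform (emb u) ((h' ** h) *v x) = hform (emb u) x \<and>
        (\<forall>l. l \<notin> {i, j} \<longrightarrow> ((h' ** h) *v x) $ l = (if l \<in> insert k K then 0 else x $ l))"
        using h'(2) h(2) by (simp flip: matrix_vector_mul_assoc)
    qed
  qed
qed

text \<open>After clearing, the vector lies in the plane of \<open>u\<close> and \<open>w\<close>. A
  boost corrects its \<open>w\<close>-coefficient. The norm then forces the error in the
  \<open>u\<close>-coefficient to change sign under \<open>bar\<close>, and two transvections remove
  it.\<close>

lemma simple_group_on_transitive:
  assumes val: "\<And>l. val_inf (v $ l) (axis i 1 $ l)" and norm: "hform v v = sg i"
    and supp: "\<And>l. l \<notin> S \<Longrightarrow> v $ l = 0"
  shows "\<exists>h\<in>simple_group_on S. h *v v = axis i 1"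
proof -
  note hyp = hyperbolic_uw and herm = hyperbolic_herm[OF hyperbolic_uw]
  have supp_uw: "u $ k = 0" "w $ k = 0" if "k \<notin> S" for k
    using that ij by (auto simp: uw_nth)
  have "val_inf (sg i) (sg i)" using val_inf_cst[of "sg i"] by simp
  then have "val_inf (sg i * (v $ i - v $ j)) (sg i * (axis i 1 $ i - axis i 1 $ j))"
    by (intro val_inf_mult val_inf_diff val)
  then have val_u: "val_inf (hform (emb u) v) (sg i)"
    using ij_neq by (simp add: hform_u axis_nth_if)
  have "val_inf (v $ k) 0" if "k \<in> S - {i, j}" for k
    using val[of k] that by (auto simp: axis_nth_if)
  then obtain h1 where h1: "h1 \<in> simple_group_on S" "hform (emb u) (h1 *v v) = hform (emb u) v"
    "\<And>l. l \<notin> {i, j} \<Longrightarrow> (h1 *v v) $ l = (if l \<in> S - {i, j} then 0 else v $ l)"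
    using clear_coordinates[of "S - {i, j}" v] val_u by blast
  define x where "x = h1 *v v"
  define a b where "a = hform (emb w) x" and "b = hform (emb u) x"
  have x0: "x $ l = 0" if "l \<notin> {i, j}" for l
    using h1(3)[OF that] supp that by (auto simp: x_def)
  have "val_inf (x $ l) (axis i 1 $ l)" for l
    unfolding x_def using h1(1) val by (intro tends_to_1_val_inf simple_group_on_tends_to_1)
  from val_inf_divide[OF val_inf_add[OF this[of i] this[of j]] val_inf_cst[of 2]]
  have val_a: "val_inf a (1 / 2)"
    using ij_neq by (simp add: a_def hform_w axis_nth_if)
  have val_b: "val_inf b (sg i)" using val_u h1(2) by (simp add: b_def x_def)
  have "x $ l = (a *s emb u + b *s emb w) $ l" for l
    unfolding a_def b_def hform_u hform_w using ij_neq x0[of l]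
    by (cases "l = i"; cases "l = j") (auto simp: uw_nth field_simps)
  then have x: "x = a *s emb u + b *s emb w" by (simp add: vec_eq_iff)
  \<comment> \<open>The boost divides the \<open>w\<close>-coefficient by
    \<open>bar r = sg i * b\<close>, turning \<open>b\<close> into \<open>sg i\<close>.\<close>
  define r where "r = bar (sg i * b)"
  have "val_inf (sg i * b) 1"
    using val_inf_mult[OF val_inf_cst[of "sg i"] val_b] by simp
  from val_inf_bar[OF this] have r: "val_inf r 1" by (simp only: r_def complex_cnj_one)
  have b0: "b \<noteq> 0" using val_inf_neq_0[OF val_b] by simp
  define h2 where "h2 = boost r u w"
  have h2: "h2 \<in> simple_group_on S"
    unfolding h2_def using hyp r supp_uw by (rule boost_in_simple_group_on)
  have "(1 / bar r - 1) * b + b = sg i"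
    using b0 by (cases i) (simp_all add: r_def field_simps)
  then have h2x: "h2 *v x = (r * a) *s emb u + sg i *s emb w"
    unfolding h2_def boost_mult a_def[symmetric] b_def[symmetric]
    by (simp add: x vec_eq_iff algebra_simps flip: distrib_right)
  \<comment> \<open>The target is \<open>axis i 1 = (1 / 2) *s emb u + sg i *s emb w\<close>, so
    this is the remaining error.\<close>
  define \<sigma> where "\<sigma> = r * a - 1 / 2"
  have "hform (h2 *v x) (h2 *v x) = hform v v"
    using h2 h1(1) simple_group_on_isometry unfolding x_def isometry_def by metis
  then have "sg i * (bar (r * a) + r * a) = sg i"
    unfolding h2x norm by (simp add: hform_simps hform_emb herm algebra_simps)
  then have "bar (r * a) + r * a = 1"
    by (metis mult_cancel_left2 sg_neq_0)
  then have bar_\<sigma>: "bar \<sigma> = - \<sigma>"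
    by (simp add: \<sigma>_def algebra_simps)
  have val_\<sigma>: "val_inf \<sigma> 0"
    using val_inf_diff[OF val_inf_mult[OF r val_a] val_inf_cst[of "1 / 2"]] by (simp add: \<sigma>_def)
  define J where "J = cst \<i>"
  have J: "J * J = - 1" "bar J = - J"
    by (simp_all add: J_def flip: cst_simps)
  \<comment> \<open>The term \<open>1 - r * bar r\<close> of a transvection is quadratic; the
    parameters \<open>1 + f\<close> and \<open>1 - f\<close> with opposite constants
    \<open>J\<close> and \<open>- J\<close> leave only the linear term \<open>- 4 * J * f\<close>.
    This \<open>f\<close>, invariant under \<open>bar\<close>, solves
    \<open>4 * J * f * sg i = \<sigma>\<close>.\<close>
  define f where "f = - J * \<sigma> * sg i / 4"
  have bar_f: "bar f = f" by (simp add: f_def J bar_\<sigma>)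
  have "val_inf f (- \<i> * 0 * sg i / 4)"
    unfolding f_def J_def cst_sg[symmetric] cst_numeral[symmetric] cst_simps(5)[symmetric]
    by (intro val_inf_mult val_inf_divide val_inf_cst val_\<sigma>) simp
  then have val_f: "val_inf f 0" by simp
  obtain h3 where h3: "h3 \<in> simple_group_on S"
    "\<And>x. h3 *v x = x + (J * (1 - (1 + f) * bar (1 + f)) * hform (emb u) x) *s emb u"
    using transvection[OF hyp, of "1 + f" \<i> S] val_inf_add[OF val_inf_1 val_f] supp_uw
    unfolding J_def by auto
  obtain h4 where h4: "h4 \<in> simple_group_on S"
    "\<And>x. h4 *v x = x + (- J * (1 - (1 - f) * bar (1 - f)) * hform (emb u) x) *s emb u"
    using transvection[OF hyp, of "1 - f" "- \<i>" S] val_inf_diff[OF val_inf_1 val_f] supp_uw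
    unfolding J_def by auto
  have u_h2x: "hform (emb u) (h2 *v x) = sg i"
    unfolding h2x by (simp add: hform_simps hform_emb herm)
  have u_h3: "hform (emb u) (h3 *v (h2 *v x)) = sg i"
    unfolding h3(2) by (simp add: hform_simps hform_emb herm u_h2x)
  have "h4 *v (h3 *v (h2 *v x)) = (r * a + J * (1 - (1 + f) * bar (1 + f)) * sg i
      + - J * (1 - (1 - f) * bar (1 - f)) * sg i) *s emb u + sg i *s emb w"
    unfolding h4(2) u_h3 unfolding h3(2) u_h2x unfolding h2x
    by (simp add: vec_eq_iff distrib_right)
  also have "r * a + J * (1 - (1 + f) * bar (1 + f)) * sg i
      + - J * (1 - (1 - f) * bar (1 - f)) * sg i = r * a - 4 * J * f * sg i"
    by (simp add: bar_f algebra_simps)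
  also have "4 * J * f * sg i = - (J * J) * \<sigma> * (sg i * sg i)"
    by (simp add: f_def algebra_simps del: sg_sg)
  also have "r * a - \<dots> = 1 / 2" by (simp add: J \<sigma>_def)
  also have "(1 / 2) *s emb u + sg i *s emb w = axis i 1"
    unfolding vec_eq_iff using ij_neq by (auto simp: uw_nth axis_nth_if)
  finally have "(h4 ** (h3 ** (h2 ** h1))) *v v = axis i 1"
    by (simp add: x_def flip: matrix_vector_mul_assoc)
  moreover have "h4 ** (h3 ** (h2 ** h1)) \<in> simple_group_on S"
    using h1(1) h2 h3(1) h4(1) by (intro simple_group_on_mult)
  ultimately show ?thesis by blast
qed

text \<open>An element of the generated group takes \<open>g *v axis i 1\<close> back to
  \<open>axis i 1\<close>, so the composite acts on one coordinate fewer; undoing that element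
  recovers \<open>g\<close>.\<close>

lemma descend:
  assumes g: "g \<in> LU" "acts_on S g"
    and IH: "\<And>g. g \<in> LU \<Longrightarrow> acts_on (S - {i}) g \<Longrightarrow> g \<in> simple_group"
  shows "g \<in> simple_group"
proof -
  have iso: "isometry g" and tt: "tends_to_1 g" using g by (auto simp: LU_iff)
  let ?v = "g *v axis i 1"
  have "val_inf (?v $ l) (axis i 1 $ l)" for l
    using tt unfolding matrix_axis_nth tends_to_1_def by (simp add: axis_nth_if mat_def)
  moreover have "hform ?v ?v = sg i"
    using iso unfolding isometry_def by (simp add: axis_nth_if)
  moreover have "?v $ l = 0" if "l \<notin> S" for l
    unfolding acts_on_nth[OF iso g(2) that] using that ij by (auto simp: axis_nth_if)
  ultimately obtain h where h: "h \<in> simple_group_on S" "h *v ?v = axis i 1"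
    using simple_group_on_transitive by blast
  have hG: "h \<in> simple_group" using h(1) by (simp add: simple_group_on_def)
  have "h ** g \<in> LU" by (rule LU_mult[OF simple_group_subset_LU[OF hG] g(1)])
  moreover have "acts_on (S - {i}) (h ** g)"
    using h g by (auto simp: acts_on_def simple_group_on_def simp flip: matrix_vector_mul_assoc)
  ultimately have hg: "h ** g \<in> simple_group" by (rule IH)
  obtain k where k: "k \<in> simple_group" "k ** h = mat 1"
    using simple_group_inverse[OF hG] by blast
  have "g = k ** (h ** g)" using k(2) by (metis matrix_mul_assoc matrix_mul_lid)
  with simple_group_mult[OF k(1) hg] show ?thesis by simp
qed

end

text \<open>Only a scaling of \<open>axis i 1\<close> by some \<open>r\<close> remains, and the
  isometry condition gives \<open>r * bar r = 1\<close>.\<close>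

lemma LU_acts_on_singleton:
  assumes g: "g \<in> LU" "acts_on {i} g"
  shows "g \<in> simple_group"
proof -
  have iso: "isometry g" and tt: "tends_to_1 g" using g by (auto simp: LU_iff)
  define r where "r = g $ i $ i"
  have "(g *v axis i 1) $ k = axis i r $ k" for k
    using acts_on_nth[OF iso g(2), of k "axis i 1"] matrix_axis_nth[of g i k]
    by (cases "k = i") (auto simp: axis_nth_if r_def)
  then have gi: "g *v axis i 1 = axis i r" by (simp add: vec_eq_iff)
  have "hform (g *v axis i 1) (g *v axis i 1) = hform (axis i 1) (axis i 1)"
    using iso unfolding isometry_def by blast
  then have "sg i * (r * bar r) = sg i" unfolding gi by (simp add: axis_nth_if mult_ac)
  then have rr: "r * bar r = 1" by (metis mult_cancel_left2 sg_neq_0)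
  have val: "val_inf r 1" using tt by (simp add: tends_to_1_def r_def mat_def) (metis)
  have nz: "herm (axis i 1) (axis i 1 :: complex^('a + 'b)) \<noteq> 0" by (simp add: axis_nth_if)
  have "g = scaling r (axis i 1)"
  proof (rule matrix_eq_axisI)
    fix k
    show "g *v axis k 1 = scaling r (axis i 1) *v axis k 1"
    proof (cases "k = i")
      case True
      then show ?thesis by (simp add: gi scaling_mult vec_eq_iff) (simp add: axis_nth_if)
    next
      case False
      then show ?thesis using g(2) by (simp add: scaling_mult acts_on_def) (simp add: axis_nth_if vec_eq_iff)
    qed
  qed
  with scaling_in_simple_group[OF nz val rr] show ?thesis by simp
qed

text \<open>The coordinates \<open>Inl a\<close> and \<open>Inr b\<close> are kept to the end, so
  every other coordinate finds a partner of opposite sign when it is split off.\<close>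

lemma LU_acts_on:
  fixes a :: "'p::finite" and b :: "'q::finite" and K :: "('p + 'q) set"
  assumes "finite K" "K \<inter> {Inl a, Inr b} = {}" "g \<in> LU" "acts_on (insert (Inl a) (insert (Inr b) K)) g"
  shows "g \<in> simple_group"
  using assms
proof (induction K arbitrary: g)
  case empty
  show ?case
  \<comment> \<open>In the last indefinite plane \<open>Inl a\<close> is split off with partner
    \<open>Inr b\<close>, which leaves the one-dimensional case.\<close>
  proof (rule descend[of "Inr b" "Inl a" "{Inl a, Inr b}" g])
    fix g :: "ratfun^('p + 'q)^('p + 'q)"
    assume "g \<in> LU" "acts_on ({Inl a, Inr b} - {Inl a}) g"
    moreover have "{Inl a, Inr b} - {Inl a} = {Inr b :: 'p + 'q}" by auto
    ultimately show "g \<in> simple_group" using LU_acts_on_singleton by metis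
  qed (use empty in auto)
next
  case (insert k K)
  let ?S = "insert (Inl a) (insert (Inr b) (insert k K))"
  obtain j where j: "j \<in> {Inl a, Inr b}" "(sg j :: complex) = - sg k"
    by (cases k) (auto intro: that[of "Inl a"] that[of "Inr b"])
  show ?case
  proof (rule descend[of j k ?S g])
    fix g :: "ratfun^('p + 'q)^('p + 'q)"
    assume "g \<in> LU" "acts_on (?S - {k}) g"
    moreover have "?S - {k} = insert (Inl a) (insert (Inr b) K)" using insert.hyps insert.prems by auto
    ultimately show "g \<in> simple_group" using insert.IH[of g] insert.prems by simp
  qed (use insert j in auto)
qed

theorem theorem5p7:
  assumes "0 < CARD('p::finite)" and "CARD('p) \<le> CARD('q::finite)"
  shows "generate LGL (p_family \<union> g_family) = (LU :: (ratfun^('p + 'q)^('p + 'q)) set)"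
proof (intro equalityI subsetI)
  fix g :: "ratfun^('p + 'q)^('p + 'q)"
  show "g \<in> simple_group \<Longrightarrow> g \<in> LU" by (rule simple_group_subset_LU)
  assume "g \<in> LU"
  then show "g \<in> simple_group"
    \<comment> \<open>Any negative and any positive coordinate may serve as the final pair. Together
      with the rest they exhaust all coordinates, so the condition \<open>acts_on\<close> holds
      vacuously.\<close>
    by (intro LU_acts_on[of "UNIV - {Inl undefined, Inr undefined}" undefined undefined])
      (auto simp: acts_on_def)
qed

end
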